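(* Let $n\ge 1$, $c\ge 2$ be integers and $\alpha\neq\beta$ colors in $\{1,\dots,c\}$. Then $\left|\Pi_n^{eq}\wr C_c(1^\alpha1^\beta2^\alpha)\right|$ equals $$B(n)(c-1)^n+\sum_{k=1}^n\sum_{j=1}^k\binom{n}{k}\binom{k}{j}B(n-k)(c-1)^{n-j}$$ $$+\sum_{1\le i<j\le n}\sum_{a,b}\sum_{d,e}\sum_{f,g}\sum_k\sum_{p,q}\sum_{\ell}\binom{i-1}{a,b}\binom{j-i-1}{d,e}\binom{n-j}{f,g}\binom{i-a-b-1}{k}\binom{j-i-d-e-1}{p}\binom{n-a-b-f-g-j+i-k-1}{q}S(p+q,\ell)\,k^{\underline{\ell}}$$ $$\cdot B(n-a-b-d-e-f-g-k-p-q-2)\bigl((c-1)^b+b(c-1)^{b-1}\bigr)\bigl((c-1)^a+a(c-1)^{a-1}\bigr)(c-2)^{d+p}c^e(c-1)^{n-a-b-d-e-k-p-2},$$ where $k^{\underline{\ell}}=k(k-1)\cdots(k-\ell+1)$.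
   Context: $\Pi_n\wr C_c$ is the set of colored set partitions of $[n]$: a set partition of $[n]$ together with a color in $\{1,\dots,c\}$ for each element. A colored partition eq-contains $1^\alpha1^\beta2^\alpha$ iff there are elements $x<y<z$ with $x,y$ in the same block, $z$ in a different block, $x,z$ colored $\alpha$ and $y$ colored $\beta$; $\Pi_n^{eq}\wr C_c(1^\alpha1^\beta2^\alpha)$ is the set of those that do not. $B(m)$ is the $m$-th Bell number and $S(N,\ell)$ the Stirling number of the second kind. Conventions: $\sum_{x,y}$, $\sum_x$ range over all nonnegative integers; $\binom{N}{x,y}=\frac{N!}{x!\,y!\,(N-x-y)!}$ when $x+y\le N$ and $0$ otherwise; $\binom{N}{p}=0$ unless $0\le p\le N$; $k^{\underline{0}}=1$; a term $x(c-1)^{x-1}$ with $x=0$ is $0$; $0^0=1$. *)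

theory Defs
  imports
    "HOL-Library.FuncSet"
    "HOL-Library.Disjoint_Sets"
    "HOL-Library.Groups_Big_Fun"
    "HOL-Combinatorics.Stirling"
begin

text \<open>A colored partition is a pair of a set partition of \<open>[n]\<close> and a coloring; colorings are
  extensional functions, so that distinct pairs are distinct colored partitions.\<close>

definition colored_partitions :: "nat \<Rightarrow> nat \<Rightarrow> (nat set set \<times> (nat \<Rightarrow> nat)) set" where
  "colored_partitions n c =
     {(P, col). partition_on {1..n} P \<and> col \<in> {1..n} \<rightarrow>\<^sub>E {1..c}}"

definition eq_contains_112 :: "nat \<Rightarrow> nat \<Rightarrow> nat set set \<times> (nat \<Rightarrow> nat) \<Rightarrow> bool" where
  "eq_contains_112 \<alpha> \<beta> = (\<lambda>(P, col).
     \<exists>x y z. x < y \<and> y < z \<and>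
       (\<exists>X\<in>P. \<exists>Z\<in>P. X \<noteq> Z \<and> x \<in> X \<and> y \<in> X \<and> z \<in> Z) \<and>
       col x = \<alpha> \<and> col y = \<beta> \<and> col z = \<alpha>)"

definition eq_avoiders_112 ::
    "nat \<Rightarrow> nat \<Rightarrow> nat \<Rightarrow> nat \<Rightarrow> (nat set set \<times> (nat \<Rightarrow> nat)) set" where
  "eq_avoiders_112 n c \<alpha> \<beta> = {\<pi> \<in> colored_partitions n c. \<not> eq_contains_112 \<alpha> \<beta> \<pi>}"

definition Bell :: "nat \<Rightarrow> nat" where
  "Bell m = card {P. partition_on {1..m} P}"

definition trinom :: "nat \<Rightarrow> nat \<Rightarrow> nat \<Rightarrow> nat" where
  "trinom N x y = (if x + y \<le> N then fact N div (fact x * fact y * fact (N - x - y)) else 0)"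

text \<open>Truncated subtraction is harmless here: for \<open>k < l\<close> the factor with \<open>i = k\<close> is zero.\<close>

definition falling_fact :: "nat \<Rightarrow> nat \<Rightarrow> nat" where
  "falling_fact k l = (\<Prod>i<l. k - i)"

text \<open>Sums over all natural numbers of finitely supported functions. The separate symbol avoids
  a clash with the notation for infinite series.

  In the counting formula these sums run over summands containing differences of natural numbers.
  Whenever such a difference would be negative, one of the factors \<open>trinom\<close> or \<open>choose\<close> of the
  summand is zero (and \<open>x * (c - 1) ^ (x - 1)\<close> is zero for \<open>x = 0\<close>), so truncated subtraction does not change the value. To keep this true, the upper
  entry \<open>n - a - b - f - g - j + i - k - 1\<close> has its only other positive summand moved to the front.\<close>

notation Sum_any (binder "\<Sum>\<^sub>\<nat>" 10)

end

theory Submission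
  imports Defs
begin

text \<open>
  If no element has colour \<open>\<alpha>\<close>, or all of them lie in one block, the pattern cannot occur; this gives
  the first two terms. Otherwise let \<open>j\<close> be the last element of colour \<open>\<alpha>\<close> and \<open>i\<close> the last one outside
  the block of \<open>j\<close>. Avoidance then becomes a condition on each block separately: in the block of \<open>j\<close> no
  \<open>\<alpha>\<close> precedes a \<open>\<beta>\<close> located before \<open>i\<close>, in any other block no \<open>\<alpha>\<close> precedes a \<open>\<beta>\<close> located before \<open>j\<close>.
  Hence the number of avoiders with given \<open>(i, j)\<close> is a sum over set partitions of a product of block
  weights. The blocks of \<open>i\<close> and \<open>j\<close> are split off and contribute the sizes \<open>(a, d, f)\<close> and
  \<open>(b, e, g)\<close> to the left of \<open>i\<close>, between \<open>i\<close> and \<open>j\<close>, and to the right of \<open>j\<close>. In a remaining block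
  containing \<open>\<alpha>\<close> the first \<open>\<alpha>\<close> serves as a root, which lies before \<open>i\<close>: there are \<open>k\<close> roots, and
  \<open>p + q\<close> further elements choose one of them, in \<open>k ^ (p + q) = (\<Sum>l. S(p + q, l) k (k - 1) \<dots> (k - l + 1))\<close>
  ways. The blocks without \<open>\<alpha>\<close> form an arbitrary partition, counted by a Bell number.
\<close>

section \<open>Sums over subsets\<close>

text \<open>Subsets are grouped by size. The upper limit \<open>n\<close> may exceed
  \<open>card A\<close>, since the surplus binomials vanish; this lets all later size sums share the
  range \<open>{..n}\<close>.\<close>

lemma sum_Pow_card:
  fixes F :: "nat \<Rightarrow> nat"
  assumes "finite A" and "card A \<le> n"
  shows "(\<Sum>S\<in>Pow A. F (card S)) = (\<Sum>k\<le>n. (card A choose k) * F k)"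
proof -
  have "(\<Sum>S\<in>Pow A. F (card S)) = (\<Sum>k\<le>n. \<Sum>S\<in>{S \<in> Pow A. card S = k}. F (card S))"
    using assms
    by (intro sum.group[symmetric]) (auto intro: le_trans[OF card_mono])
  also have "\<dots> = (\<Sum>k\<le>n. (card A choose k) * F k)"
    using assms by (intro sum.cong) (auto simp: n_subsets)
  finally show ?thesis .
qed

lemma sum_Pow_Un:
  fixes F :: "'a set \<Rightarrow> 'b::comm_monoid_add"
  assumes "A \<inter> B = {}"
  shows "(\<Sum>S\<in>Pow (A \<union> B). F S) = (\<Sum>S\<in>Pow A. \<Sum>R\<in>Pow B. F (S \<union> R))"
  unfolding sum.cartesian_product
proof (rule sum.reindex_bij_witness[of _ "\<lambda>(S, R). S \<union> R" "\<lambda>S. (S \<inter> A, S \<inter> B)"])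
  fix S assume "S \<in> Pow (A \<union> B)"
  then have "S \<inter> A \<union> S \<inter> B = S" by blast
  then show "(case (S \<inter> A, S \<inter> B) of (S, R) \<Rightarrow> S \<union> R) = S"
    and "(case (S \<inter> A, S \<inter> B) of (S, R) \<Rightarrow> F (S \<union> R)) = F S" by simp_all
qed (use assms in auto)

lemma sum_Pow_card2:
  fixes F :: "nat \<Rightarrow> nat \<Rightarrow> nat"
  assumes "finite A" "finite B" "A \<inter> B = {}" "card A \<le> n" "card B \<le> n"
  shows "(\<Sum>S\<in>Pow (A \<union> B). F (card (S \<inter> A)) (card (S \<inter> B))) =
    (\<Sum>x\<le>n. \<Sum>y\<le>n. (card A choose x) * (card B choose y) * F x y)"
proof -
  have "(\<Sum>S\<in>Pow (A \<union> B). F (card (S \<inter> A)) (card (S \<inter> B)))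
      = (\<Sum>S\<in>Pow A. \<Sum>R\<in>Pow B. F (card S) (card R))"
    unfolding sum_Pow_Un[OF assms(3)] using assms(3)
    by (intro sum.cong refl arg_cong2[where f = F] arg_cong[where f = card]) auto
  also have "\<dots> = (\<Sum>x\<le>n. \<Sum>y\<le>n. (card A choose x) * (card B choose y) * F x y)"
    unfolding sum_Pow_card[OF assms(2,5)] sum_Pow_card[OF assms(1,4), of "\<lambda>x. \<Sum>y\<le>n. (card B choose y) * F x y"]
    by (simp add: sum_distrib_left mult.assoc)
  finally show ?thesis .
qed

text \<open>The three sets will be the positions left of \<open>i\<close>, between \<open>i\<close>
  and \<open>j\<close>, and right of \<open>j\<close>; the weights of the blocks of \<open>i\<close>
  and \<open>j\<close> depend only on their sizes in these regions.\<close>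

lemma sum_Pow_card3:
  fixes F :: "nat \<Rightarrow> nat \<Rightarrow> nat \<Rightarrow> nat"
  assumes "finite A" "finite B" "finite C" "A \<inter> B = {}" "A \<inter> C = {}" "B \<inter> C = {}"
    and "card A \<le> n" "card B \<le> n" "card C \<le> n"
  shows "(\<Sum>S\<in>Pow (A \<union> B \<union> C). F (card (S \<inter> A)) (card (S \<inter> B)) (card (S \<inter> C))) =
    (\<Sum>x\<le>n. \<Sum>y\<le>n. \<Sum>z\<le>n.
      (card A choose x) * (card B choose y) * (card C choose z) * F x y z)"
proof -
  have disj: "(A \<union> B) \<inter> C = {}" using assms by auto
  have "(\<Sum>S\<in>Pow (A \<union> B \<union> C). F (card (S \<inter> A)) (card (S \<inter> B)) (card (S \<inter> C)))
      = (\<Sum>S\<in>Pow (A \<union> B). \<Sum>R\<in>Pow C. F (card (S \<inter> A)) (card (S \<inter> B)) (card R))"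
    unfolding sum_Pow_Un[OF disj]
  proof (intro sum.cong refl)
    fix S R assume "S \<in> Pow (A \<union> B)" "R \<in> Pow C"
    then have "(S \<union> R) \<inter> A = S \<inter> A" "(S \<union> R) \<inter> B = S \<inter> B" "(S \<union> R) \<inter> C = R"
      using assms(4-6) by auto
    then show "F (card ((S \<union> R) \<inter> A)) (card ((S \<union> R) \<inter> B)) (card ((S \<union> R) \<inter> C))
        = F (card (S \<inter> A)) (card (S \<inter> B)) (card R)" by simp
  qed
  also have "\<dots> = (\<Sum>S\<in>Pow (A \<union> B). \<Sum>z\<le>n. (card C choose z) * F (card (S \<inter> A)) (card (S \<inter> B)) z)"
    by (simp add: sum_Pow_card[where n = n] assms)
  also have "\<dots> = (\<Sum>x\<le>n. \<Sum>y\<le>n. (card A choose x) * (card B choose y) *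
      (\<Sum>z\<le>n. (card C choose z) * F x y z))"
    by (rule sum_Pow_card2) (use assms in auto)
  finally show ?thesis by (simp add: sum_distrib_left mult.assoc)
qed

text \<open>The binomial theorem in subset form. With \<open>x\<close> the number of old roots, an
  element of \<open>S\<close> chooses a new root and an element outside \<open>S\<close> one of the
  old ones.\<close>

lemma power_card_sum_Pow:
  fixes x :: "'b::comm_semiring_1"
  assumes "finite A"
  shows "(\<Sum>S\<in>Pow A. x ^ card (A - S)) = (1 + x) ^ card A"
  using assms
proof (induction A)
  case (insert u A)
  have un: "insert u A = A \<union> {u}" by simp
  have "(\<Sum>S\<in>Pow (insert u A). x ^ card (insert u A - S)) =
      (\<Sum>S\<in>Pow A. x ^ card (insert u A - S) + x ^ card (insert u A - insert u S))"
    unfolding un by (subst sum_Pow_Un) (use insert in \<open>auto simp: Pow_insert insert_commute\<close>)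
  also have "\<dots> = (\<Sum>S\<in>Pow A. (1 + x) * x ^ card (A - S))"
  proof (rule sum.cong)
    fix S assume S: "S \<in> Pow A"
    have "insert u A - S = insert u (A - S)" "insert u A - insert u S = A - S"
      using S insert by auto
    then show "x ^ card (insert u A - S) + x ^ card (insert u A - insert u S) = (1 + x) * x ^ card (A - S)"
      using insert by (simp add: algebra_simps)
  qed simp
  finally show ?case
    using insert by (simp flip: sum_distrib_left)
qed simp

section \<open>Stirling numbers and falling factorials\<close>

text \<open>The recursion with factor \<open>k - l\<close>, rearranged additively so that no
  truncated difference enters the later algebra. For \<open>l > k\<close> both falling factorials
  are 0.\<close>

lemma falling_fact_Suc: "falling_fact k (Suc l) + l * falling_fact k l = k * falling_fact k l"
proof (cases "l \<le> k")
  case True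
  then show ?thesis
    by (simp add: falling_fact_def mult.commute[of l] mult.commute[of k] flip: distrib_left)
next
  case False
  then have "falling_fact k l = 0" "falling_fact k (Suc l) = 0"
    by (auto simp: falling_fact_def intro!: bexI[of _ k])
  then show ?thesis by simp
qed

text \<open>Induction on \<open>m\<close>: the Stirling recurrence splits the sum in two, an index
  shift recombines the parts, and \<open>falling_fact_Suc\<close> extracts one factor
  \<open>k\<close>. Terms with \<open>l > m\<close> vanish, so any \<open>N \<ge> m\<close>
  serves.\<close>

lemma sum_Stirling_falling_fact:
  assumes "m \<le> N"
  shows "(\<Sum>l\<le>N. Stirling m l * falling_fact k l) = k ^ m"
proof -
  have "(\<Sum>l\<le>m. Stirling m l * falling_fact k l) = k ^ m"
  proof (induction m)
    case 0
    then show ?case by (simp add: falling_fact_def)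
  next
    case (Suc m)
    have "(\<Sum>l\<le>Suc m. Stirling (Suc m) l * falling_fact k l)
        = (\<Sum>l\<le>m. Stirling (Suc m) (Suc l) * falling_fact k (Suc l))"
      by (subst sum.atMost_Suc_shift) simp
    also have "\<dots> = (\<Sum>l\<le>m. Suc l * Stirling m (Suc l) * falling_fact k (Suc l))
        + (\<Sum>l\<le>m. Stirling m l * falling_fact k (Suc l))"
      by (simp add: algebra_simps sum.distrib)
    \<comment> \<open>The shift creates a term at \<open>l = 0\<close>, killed by the factor
      \<open>l\<close>; the top term \<open>l = Suc m\<close> then drops out because
      \<open>Stirling m (Suc m) = 0\<close>.\<close>
    also have "(\<Sum>l\<le>m. Suc l * Stirling m (Suc l) * falling_fact k (Suc l))
        = (\<Sum>l\<le>Suc m. l * Stirling m l * falling_fact k l)"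
      by (subst sum.atMost_Suc_shift) simp
    also have "\<dots> = (\<Sum>l\<le>m. l * Stirling m l * falling_fact k l)"
      by simp
    also have "\<dots> + (\<Sum>l\<le>m. Stirling m l * falling_fact k (Suc l))
        = (\<Sum>l\<le>m. Stirling m l * (falling_fact k (Suc l) + l * falling_fact k l))"
      by (simp add: algebra_simps sum.distrib)
    also have "\<dots> = k * (\<Sum>l\<le>m. Stirling m l * falling_fact k l)"
      by (simp add: falling_fact_Suc sum_distrib_left mult_ac)
    finally show ?case using Suc by simp
  qed
  moreover have "(\<Sum>l\<le>N. Stirling m l * falling_fact k l) = (\<Sum>l\<le>m. Stirling m l * falling_fact k l)"
    using assms by (intro sum.mono_neutral_right) auto
  ultimately show ?thesis by simp
qed

section \<open>Sums over set partitions\<close>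

text \<open>Once avoidance is a blockwise condition, counts take this multiplicative form and can be
  evaluated by splitting off one block at a time.\<close>

definition partition_sum :: "('a set \<Rightarrow> nat) \<Rightarrow> 'a set \<Rightarrow> nat" where
  "partition_sum \<phi> A = (\<Sum>P | partition_on A P. \<Prod>W\<in>P. \<phi> W)"

lemma partition_sum_cong:
  assumes "\<And>W. W \<subseteq> A \<Longrightarrow> \<phi> W = \<psi> W"
  shows "partition_sum \<phi> A = partition_sum \<psi> A"
  unfolding partition_sum_def using assms
  by (intro sum.cong prod.cong refl) (auto simp: partition_on_def)

text \<open>A partition amounts to the block \<open>insert u S\<close> of \<open>u\<close> together
  with a partition of what is left, and the weight factors accordingly.\<close>

lemma partition_sum_rec:
  assumes "finite A" and "u \<in> A"
  shows "partition_sum \<phi> A =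
    (\<Sum>S\<in>Pow (A - {u}). \<phi> (insert u S) * partition_sum \<phi> (A - insert u S))"
proof -
  \<comment> \<open>The block of \<open>P\<close> containing \<open>u\<close>, unique by
    disjointness.\<close>
  let ?b = "\<lambda>P. THE W. W \<in> P \<and> u \<in> W"
  have b: "?b P = W" if "partition_on A P" "W \<in> P" "u \<in> W" for P W
    using that by (intro the_equality) (auto simp: partition_on_def disjoint_def)
  have ex: "\<exists>W\<in>P. u \<in> W" if "partition_on A P" for P
    using that assms by (auto simp: partition_on_def)
  have fin: "finite {P. partition_on (A - insert u S) P}" for S
    using assms by (intro finitely_many_partition_on) auto
  have ins: "partition_on A (insert (insert u S) P) \<and> insert u S \<notin> P"
    if "S \<subseteq> A - {u}" "partition_on (A - insert u S) P" for S P
  proof -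
    have "disjnt (insert u S) (\<Union>P)" using that by (auto simp: partition_on_def disjnt_def)
    moreover have "insert u S \<notin> P" using that by (auto simp: partition_on_def)
    ultimately show ?thesis using that assms by (subst partition_on_insert) auto
  qed
  have del: "partition_on (A - W) (P - {W})" if "partition_on A P" "W \<in> P" for P W
  proof -
    have "disjnt W (\<Union>(P - {W}))" using that by (auto simp: partition_on_def disjnt_def disjoint_def)
    then show ?thesis
      using partition_on_insert[of W "P - {W}" A] that by (simp add: insert_absorb)
  qed
  have "(\<Sum>S\<in>Pow (A - {u}). \<phi> (insert u S) * partition_sum \<phi> (A - insert u S)) =
      (\<Sum>(S, P)\<in>Sigma (Pow (A - {u})) (\<lambda>S. {P. partition_on (A - insert u S) P}).
        \<phi> (insert u S) * (\<Prod>W\<in>P. \<phi> W))"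
    unfolding partition_sum_def sum_distrib_left using assms fin by (intro sum.Sigma) auto
  also have "\<dots> = partition_sum \<phi> A"
    unfolding partition_sum_def
  proof (rule sum.reindex_bij_witness[of _ "\<lambda>P. (?b P - {u}, P - {?b P})"
        "\<lambda>(S, P). insert (insert u S) P"])
    fix a assume "a \<in> Sigma (Pow (A - {u})) (\<lambda>S. {P. partition_on (A - insert u S) P})"
    then obtain S P where a: "a = (S, P)" and S: "S \<subseteq> A - {u}"
      and P: "partition_on (A - insert u S) P" by blast
    let ?Q = "case a of (S, P) \<Rightarrow> insert (insert u S) P"
    have eq: "?b (insert (insert u S) P) = insert u S"
      using ins[OF S P] by (intro b) auto
    then show "(?b ?Q - {u}, ?Q - {?b ?Q}) = a"
      using S ins[OF S P] unfolding a by auto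
    show "?Q \<in> {P. partition_on A P}" using ins[OF S P] unfolding a by auto
    have "finite P" using P assms finite_elements by blast
    then show "(\<Prod>W\<in>?Q. \<phi> W) = (case a of (S, P) \<Rightarrow> \<phi> (insert u S) * (\<Prod>W\<in>P. \<phi> W))"
      using ins[OF S P] unfolding a by (simp add: prod.insert)
  next
    fix P assume "P \<in> {P. partition_on A P}"
    then have P: "partition_on A P" by simp
    then obtain W where W: "W \<in> P" "u \<in> W" using ex by blast
    have eq: "?b P = W" by (rule b[OF P W])
    show "(case (?b P - {u}, P - {?b P}) of (S, P) \<Rightarrow> insert (insert u S) P) = P"
      unfolding eq using W by (auto simp: insert_absorb)
    have "W \<subseteq> A" using W P by (auto simp: partition_on_def)
    then show "(?b P - {u}, P - {?b P}) \<in> Sigma (Pow (A - {u})) (\<lambda>S. {P. partition_on (A - insert u S) P})"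
      unfolding eq using W del[OF P W(1)] by (auto simp: insert_absorb)
  qed
  finally show ?thesis by simp
qed

section \<open>Bell numbers as counts of partitions of arbitrary finite sets\<close>

lemma card_partitions_le:
  assumes "finite B" and "bij_betw h A B"
  shows "card {P. partition_on A P} \<le> card {P. partition_on B P}"
proof (rule card_inj_on_le)
  have h: "inj_on h A" "h ` A = B" using assms by (auto simp: bij_betw_def)
  have "inj_on ((`) ((`) h)) (Pow (Pow A))"
    by (intro inj_on_image_Pow h)
  then show "inj_on ((`) ((`) h)) {P. partition_on A P}"
    by (rule inj_on_subset) (auto simp: partition_on_def)
  show "(`) ((`) h) ` {P. partition_on A P} \<subseteq> {P. partition_on B P}"
  proof clarify
    fix P assume P: "partition_on A P"
    then have "(`) h ` P - {{}} = (`) h ` P" by (auto simp: partition_on_def)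
    then show "partition_on B ((`) h ` P)"
      using partition_on_inj_image[OF P h(1)] h(2) by simp
  qed
  show "finite {P. partition_on B P}" using assms by (intro finitely_many_partition_on)
qed

lemma card_partitions:
  assumes "finite A"
  shows "card {P. partition_on A P} = Bell (card A)"
proof -
  obtain h where h: "bij_betw h A {1..card A}"
    using assms by (metis finite_same_card_bij finite_atLeastAtMost card_atLeastAtMost diff_Suc_1)
  \<comment> \<open>Transport along \<open>h\<close> and along its inverse gives both
    inequalities.\<close>
  from card_partitions_le[OF _ this] card_partitions_le[OF assms bij_betw_inv_into[OF h]]
  show ?thesis by (simp add: Bell_def)
qed

text \<open>Deleting the block \<open>X\<close> is a bijection onto the partitions of
  \<open>A - X\<close>; being nonempty, \<open>X\<close> cannot already be a block there.\<close>

lemma card_partitions_containing: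
  assumes "finite A" and "X \<subseteq> A" and "X \<noteq> {}"
  shows "card {P. partition_on A P \<and> X \<in> P} = Bell (card A - card X)"
proof -
  have "bij_betw (insert X) {P. partition_on (A - X) P} {P. partition_on A P \<and> X \<in> P}"
  proof (rule bij_betw_byWitness[where f' = "\<lambda>P. P - {X}"])
    have not_in: "X \<notin> P" if "partition_on (A - X) P" for P
      using that assms(3) by (auto simp: partition_on_def)
    show "\<forall>P\<in>{P. partition_on (A - X) P}. insert X P - {X} = P"
      using not_in by auto
    show "\<forall>P\<in>{P. partition_on A P \<and> X \<in> P}. insert X (P - {X}) = P"
      by auto
    show "insert X ` {P. partition_on (A - X) P} \<subseteq> {P. partition_on A P \<and> X \<in> P}"
      using assms by (auto simp: partition_on_def disjoint_def) blast+
    show "(\<lambda>P. P - {X}) ` {P. partition_on A P \<and> X \<in> P} \<subseteq> {P. partition_on (A - X) P}"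
      using assms by (auto simp: partition_on_def disjoint_def)
  qed
  then have "card {P. partition_on A P \<and> X \<in> P} = card {P. partition_on (A - X) P}"
    by (simp add: bij_betw_same_card)
  also have "\<dots> = Bell (card A - card X)"
    using assms by (simp add: card_partitions card_Diff_subset finite_subset)
  finally show ?thesis .
qed

section \<open>Partitions with optional roots\<close>

text \<open>Distributivity: the blocks are disjoint, so independent choices of \<open>L\<close>
  inside all blocks amount to a single set \<open>K\<close>, with \<open>L\<close> recovered as
  \<open>K \<inter> W\<close>.\<close>

lemma prod_sum_Pow_blocks:
  fixes F :: "'a set \<Rightarrow> 'a set \<Rightarrow> nat"
  assumes "finite P" and "disjoint P"
  shows "(\<Prod>W\<in>P. \<Sum>L\<in>Pow (W \<inter> I). F W L) = (\<Sum>K\<in>Pow (\<Union>P \<inter> I). \<Prod>W\<in>P. F W (K \<inter> W))"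
  using assms
proof (induction P)
  case (insert W P)
  have disj: "W \<inter> \<Union>P = {}" using insert by (auto simp: disjoint_def)
  have "(\<Sum>K\<in>Pow (\<Union>(insert W P) \<inter> I). \<Prod>V\<in>insert W P. F V (K \<inter> V))
      = (\<Sum>K\<in>Pow ((W \<inter> I) \<union> (\<Union>P \<inter> I)). F W (K \<inter> W) * (\<Prod>V\<in>P. F V (K \<inter> V)))"
    using insert by (intro sum.cong) auto
  also have "\<dots> = (\<Sum>L\<in>Pow (W \<inter> I). \<Sum>K\<in>Pow (\<Union>P \<inter> I).
      F W ((L \<union> K) \<inter> W) * (\<Prod>V\<in>P. F V ((L \<union> K) \<inter> V)))"
    using disj by (intro sum_Pow_Un) auto
  also have "\<dots> = (\<Sum>L\<in>Pow (W \<inter> I). \<Sum>K\<in>Pow (\<Union>P \<inter> I). F W L * (\<Prod>V\<in>P. F V (K \<inter> V)))"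
  proof (intro sum.cong refl arg_cong2[where f = "(*)"] prod.cong)
    fix L K assume "L \<in> Pow (W \<inter> I)" "K \<in> Pow (\<Union>P \<inter> I)"
    then show "F W ((L \<union> K) \<inter> W) = F W L"
      using disj by (intro arg_cong[where f = "F W"]) blast
    show "F V ((L \<union> K) \<inter> V) = F V (K \<inter> V)" if "V \<in> P" for V
      using disj that \<open>L \<in> Pow (W \<inter> I)\<close> by (intro arg_cong[where f = "F V"]) blast
  qed
  finally show ?case
    using insert by (simp add: sum_product pairwise_insert)
qed simp

text \<open>\<open>L\<close> is a candidate set of roots of the block \<open>W\<close>. Giving
  weight 0 to two or more roots allows \<open>L\<close> to range over all subsets, so that the
  choices in different blocks are independent.\<close>

definition root_weight :: "('a \<Rightarrow> nat) \<Rightarrow> ('a \<Rightarrow> nat) \<Rightarrow> 'a set \<Rightarrow> 'a set \<Rightarrow> nat" where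
  "root_weight v w W L =
    (if L = {} then \<Prod>y\<in>W. w y else if card L = 1 then \<Prod>y\<in>W - L. v y else 0)"

lemma sum_root_weight:
  assumes "finite W"
  shows "(\<Sum>L\<in>Pow (W \<inter> I). root_weight v w W L) =
    (\<Prod>y\<in>W. w y) + (\<Sum>x\<in>W \<inter> I. \<Prod>y\<in>W - {x}. v y)"
proof -
  have fin: "finite (W \<inter> I)" using assms by simp
  let ?S = "insert {} ((\<lambda>x. {x}) ` (W \<inter> I))"
  have "(\<Sum>L\<in>Pow (W \<inter> I). root_weight v w W L) = (\<Sum>L\<in>?S. root_weight v w W L)"
  proof (rule sum.mono_neutral_right)
    show "\<forall>L\<in>Pow (W \<inter> I) - ?S. root_weight v w W L = 0"
      by (auto simp: root_weight_def card_1_singleton_iff)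
  qed (use fin in \<open>auto simp del: Pow_Int_eq\<close>)
  also have "\<dots> = root_weight v w W {} + (\<Sum>x\<in>W \<inter> I. root_weight v w W {x})"
    using fin by (subst sum.insert) (auto simp: sum.reindex)
  finally show ?thesis by (simp add: root_weight_def)
qed

text \<open>Partitions of \<open>U\<close> whose blocks meet \<open>K\<close> at most once: \<open>M\<close> collects the elements that share a
  block with an element of \<open>K\<close>; each of them chooses freely which one.\<close>

lemma partition_sum_root_weight:
  fixes U K :: "'a set"
  assumes "finite U" and "K \<subseteq> U"
  shows "partition_sum (\<lambda>W. root_weight v w W (K \<inter> W)) U =
    (\<Sum>M\<in>Pow (U - K). (\<Prod>y\<in>M. v y) * card K ^ card M *
      (\<Prod>y\<in>U - K - M. w y) * Bell (card (U - K - M)))"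
proof -
  have "finite K" using assms finite_subset by blast
  then show ?thesis using assms
  proof (induction K arbitrary: U)
    case empty
    have "partition_sum (\<lambda>W. root_weight v w W ({} \<inter> W)) U
        = (\<Sum>P | partition_on U P. \<Prod>y\<in>U. w y)"
      unfolding partition_sum_def
      using empty by (intro sum.cong) (auto simp: root_weight_def prod.partition)
    also have "\<dots> = (\<Prod>y\<in>U. w y) * Bell (card U)"
      using empty by (simp add: card_partitions)
    also have "\<dots> = (\<Sum>M\<in>{{}}. (\<Prod>y\<in>M. v y) * card ({} :: 'a set) ^ card M *
      (\<Prod>y\<in>U - {} - M. w y) * Bell (card (U - {} - M)))" by simp
    \<comment> \<open>Without roots the factor is \<open>0 ^ card M\<close>, which leaves only
      \<open>M = {}\<close>, where \<open>0 ^ 0 = 1\<close>.\<close>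
    also have "\<dots> = (\<Sum>M\<in>Pow (U - {}). (\<Prod>y\<in>M. v y) * card ({} :: 'a set) ^ card M *
      (\<Prod>y\<in>U - {} - M. w y) * Bell (card (U - {} - M)))"
      using empty by (intro sum.mono_neutral_left) (auto dest: finite_subset)
    finally show ?case .
  next
    case (insert u K)
    let ?\<phi> = "\<lambda>K W. root_weight v w W (K \<inter> W)"
    let ?R = "U - insert u K"
    have fR: "finite ?R" using insert by auto
    let ?g = "\<lambda>N. (\<Prod>y\<in>?R - N. w y) * Bell (card (?R - N))"
    \<comment> \<open>The block of the new root \<open>u\<close> is split off; \<open>S\<close> is
      the rest of that block.\<close>
    have "partition_sum (?\<phi> (insert u K)) U = (\<Sum>S\<in>Pow (U - {u}).
        ?\<phi> (insert u K) (insert u S) * partition_sum (?\<phi> (insert u K)) (U - insert u S))"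
      using insert by (intro partition_sum_rec) auto
    \<comment> \<open>A second root in the block of \<open>u\<close> makes its weight 0, so
      \<open>S\<close> consists of non-roots.\<close>
    also have "\<dots> = (\<Sum>S\<in>Pow ?R.
        ?\<phi> (insert u K) (insert u S) * partition_sum (?\<phi> (insert u K)) (U - insert u S))"
    proof (rule sum.mono_neutral_right)
      show "\<forall>S\<in>Pow (U - {u}) - Pow ?R.
        ?\<phi> (insert u K) (insert u S) * partition_sum (?\<phi> (insert u K)) (U - insert u S) = 0"
      proof
        fix S assume S: "S \<in> Pow (U - {u}) - Pow ?R"
        then obtain x where x: "x \<in> S" "x \<in> K" by auto
        then have "{u, x} \<subseteq> insert u K \<inter> insert u S" "u \<noteq> x" using insert by auto
        then have "card (insert u K \<inter> insert u S) \<ge> 2"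
          using insert.hyps(1) by (metis card_2_iff card_mono finite.insertI finite_Int)
        then have "?\<phi> (insert u K) (insert u S) = 0" unfolding root_weight_def by auto
        then show "?\<phi> (insert u K) (insert u S) * partition_sum (?\<phi> (insert u K)) (U - insert u S) = 0"
          by simp
      qed
    qed (use insert in auto)
    also have "\<dots> = (\<Sum>S\<in>Pow ?R. (\<Prod>y\<in>S. v y) * partition_sum (?\<phi> K) (U - insert u S))"
    proof (intro sum.cong refl arg_cong2[where f = "(*)"] partition_sum_cong)
      fix S assume S: "S \<in> Pow ?R"
      then have "insert u K \<inter> insert u S = {u}" "insert u S - {u} = S" by auto
      then show "?\<phi> (insert u K) (insert u S) = (\<Prod>y\<in>S. v y)"
        unfolding root_weight_def by (simp only:) simp
      show "?\<phi> (insert u K) W = ?\<phi> K W" if "W \<subseteq> U - insert u S" for W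
      proof -
        have "insert u K \<inter> W = K \<inter> W" using that by auto
        then show ?thesis by (simp only:)
      qed
    qed
    also have "\<dots> = (\<Sum>S\<in>Pow ?R. (\<Prod>y\<in>S. v y) *
        (\<Sum>M\<in>Pow (?R - S). (\<Prod>y\<in>M. v y) * card K ^ card M * ?g (S \<union> M)))"
    proof (intro sum.cong refl arg_cong2[where f = "(*)"])
      fix S assume S: "S \<in> Pow ?R"
      have "U - insert u S - K = ?R - S" by auto
      moreover have "partition_sum (?\<phi> K) (U - insert u S) =
        (\<Sum>M\<in>Pow (U - insert u S - K). (\<Prod>y\<in>M. v y) * card K ^ card M *
         (\<Prod>y\<in>U - insert u S - K - M. w y) * Bell (card (U - insert u S - K - M)))"
        using insert S by (intro insert.IH) auto
      moreover have "?R - S - M = ?R - (S \<union> M)" for M by auto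
      ultimately show "partition_sum (?\<phi> K) (U - insert u S) =
        (\<Sum>M\<in>Pow (?R - S). (\<Prod>y\<in>M. v y) * card K ^ card M * ?g (S \<union> M))"
        by (simp only: mult.assoc)
    qed
    also have "\<dots> = (\<Sum>(S, M)\<in>Sigma (Pow ?R) (\<lambda>S. Pow (?R - S)).
        (\<Prod>y\<in>S. v y) * ((\<Prod>y\<in>M. v y) * card K ^ card M * ?g (S \<union> M)))"
      unfolding sum_distrib_left using fR by (intro sum.Sigma) auto
    \<comment> \<open>\<open>N = S \<union> M\<close> collects the elements attached to any root;
      those in \<open>S\<close> are attached to \<open>u\<close>.\<close>
    also have "\<dots> = (\<Sum>(N, S)\<in>Sigma (Pow ?R) Pow. (\<Prod>y\<in>N. v y) * card K ^ card (N - S) * ?g N)"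
    proof (rule sum.reindex_bij_witness[of _ "\<lambda>(N, S). (S, N - S)" "\<lambda>(S, M). (S \<union> M, S)"])
      fix a assume "a \<in> Sigma (Pow ?R) (\<lambda>S. Pow (?R - S))"
      then obtain S M where a: "a = (S, M)" and SM: "S \<in> Pow ?R" "M \<in> Pow (?R - S)" by blast
      have "finite S" "finite M" using SM fR by (auto intro: finite_subset)
      then have "(\<Prod>y\<in>S \<union> M. v y) = (\<Prod>y\<in>S. v y) * (\<Prod>y\<in>M. v y)"
        using SM by (intro prod.union_disjoint) auto
      moreover have "S \<union> M - S = M" using SM by auto
      ultimately show "(case (case a of (S, M) \<Rightarrow> (S \<union> M, S)) of (N, S) \<Rightarrow>
          (\<Prod>y\<in>N. v y) * card K ^ card (N - S) * ?g N) =
        (case a of (S, M) \<Rightarrow> (\<Prod>y\<in>S. v y) * ((\<Prod>y\<in>M. v y) * card K ^ card M * ?g (S \<union> M)))"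
        unfolding a by (simp add: mult_ac)
    qed auto
    also have "\<dots> = (\<Sum>N\<in>Pow ?R. \<Sum>S\<in>Pow N. (\<Prod>y\<in>N. v y) * card K ^ card (N - S) * ?g N)"
      using fR by (intro sum.Sigma[symmetric]) (auto intro: finite_subset)
    \<comment> \<open>Each element of \<open>N\<close> chooses \<open>u\<close> or one of the roots
      in \<open>K\<close>, which turns the sum over \<open>S\<close> into a power of
      \<open>1 + card K\<close>.\<close>
    also have "\<dots> = (\<Sum>N\<in>Pow ?R. (\<Prod>y\<in>N. v y) * card (insert u K) ^ card N * ?g N)"
    proof (intro sum.cong refl)
      fix N assume "N \<in> Pow ?R"
      then have "finite N" using fR by (auto intro: finite_subset)
      then have "(\<Sum>S\<in>Pow N. card K ^ card (N - S)) = card (insert u K) ^ card N"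
        using insert by (simp add: power_card_sum_Pow)
      then show "(\<Sum>S\<in>Pow N. (\<Prod>y\<in>N. v y) * card K ^ card (N - S) * ?g N) =
         (\<Prod>y\<in>N. v y) * card (insert u K) ^ card N * ?g N"
        by (simp flip: sum_distrib_left sum_distrib_right)
    qed
    finally show ?case by (simp add: mult.assoc)
  qed
qed

text \<open>Each block weight is expanded over candidate root sets, the local choices are merged
  into one set \<open>K\<close> of roots, and after swapping the sums
  \<open>partition_sum_root_weight\<close> evaluates the term of each \<open>K\<close>.\<close>

lemma partition_sum_optional_roots:
  assumes "finite U"
  shows "partition_sum (\<lambda>W. (\<Prod>y\<in>W. w y) + (\<Sum>x\<in>W \<inter> I. \<Prod>y\<in>W - {x}. v y)) U =
    (\<Sum>K\<in>Pow (U \<inter> I). \<Sum>M\<in>Pow (U - K). (\<Prod>y\<in>M. v y) * card K ^ card M *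
      (\<Prod>y\<in>U - K - M. w y) * Bell (card (U - K - M)))"
proof -
  have "partition_sum (\<lambda>W. (\<Prod>y\<in>W. w y) + (\<Sum>x\<in>W \<inter> I. \<Prod>y\<in>W - {x}. v y)) U
      = partition_sum (\<lambda>W. \<Sum>L\<in>Pow (W \<inter> I). root_weight v w W L) U"
    using assms by (intro partition_sum_cong) (simp add: sum_root_weight finite_subset del: Pow_Int_eq)
  also have "\<dots> = (\<Sum>P | partition_on U P. \<Sum>K\<in>Pow (U \<inter> I). \<Prod>W\<in>P. root_weight v w W (K \<inter> W))"
    unfolding partition_sum_def
  proof (intro sum.cong refl)
    fix P assume "P \<in> {P. partition_on U P}"
    then have "finite P" "disjoint P" "\<Union>P = U"
      using assms by (auto simp: partition_on_def intro: finite_UnionD)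
    then show "(\<Prod>W\<in>P. \<Sum>L\<in>Pow (W \<inter> I). root_weight v w W L) =
        (\<Sum>K\<in>Pow (U \<inter> I). \<Prod>W\<in>P. root_weight v w W (K \<inter> W))"
      using prod_sum_Pow_blocks[of P "root_weight v w" I] by simp
  qed
  also have "\<dots> = (\<Sum>K\<in>Pow (U \<inter> I). partition_sum (\<lambda>W. root_weight v w W (K \<inter> W)) U)"
    unfolding partition_sum_def by (rule sum.swap)
  also have "\<dots> = (\<Sum>K\<in>Pow (U \<inter> I). \<Sum>M\<in>Pow (U - K). (\<Prod>y\<in>M. v y) * card K ^ card M *
      (\<Prod>y\<in>U - K - M. w y) * Bell (card (U - K - M)))"
    using assms by (intro sum.cong refl partition_sum_root_weight) auto
  finally show ?thesis .
qed

section \<open>Counting colourings\<close>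

text \<open>The condition \<open>Q W\<close> sees only the values on \<open>W\<close>, so a
  colouring is an independent family of restrictions to the blocks and the counts multiply.\<close>

lemma card_colourings_blocks:
  assumes "finite P" and "disjoint P"
    and local: "\<And>W f g. W \<in> P \<Longrightarrow> (\<And>y. y \<in> W \<Longrightarrow> f y = g y) \<Longrightarrow> Q W f = Q W g"
  shows "card {f \<in> \<Union>P \<rightarrow>\<^sub>E C. \<forall>W\<in>P. Q W f} = (\<Prod>W\<in>P. card {f \<in> W \<rightarrow>\<^sub>E C. Q W f})"
proof -
  let ?b = "\<lambda>y. THE W. W \<in> P \<and> y \<in> W"
  \<comment> \<open>Each point takes its value from the function of its own block; this inverts the
    passage to restrictions.\<close>
  let ?glue = "\<lambda>F. \<lambda>y\<in>\<Union>P. F (?b y) y"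
  let ?T = "\<Pi>\<^sub>E W\<in>P. {f \<in> W \<rightarrow>\<^sub>E C. Q W f}"
  have b: "?b y = W" if "W \<in> P" "y \<in> W" for W y
    using that assms(2) by (intro the_equality) (auto simp: disjoint_def)
  have glue: "?glue F y = F W y" if "W \<in> P" "y \<in> W" for F W y
  proof -
    have "?glue F y = F (?b y) y" using that by (intro restrict_apply') blast
    then show ?thesis by (simp only: b[OF that])
  qed
  have restr: "Q W (restrict f W) = Q W f" if "W \<in> P" for W f
    using that by (intro local) auto
  have glueQ: "Q W (?glue F) = Q W (F W)" if "W \<in> P" for W F
    by (rule local[OF that], rule glue[OF that])
  have "bij_betw (\<lambda>f. \<lambda>W\<in>P. restrict f W) {f \<in> \<Union>P \<rightarrow>\<^sub>E C. \<forall>W\<in>P. Q W f} ?T"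
  proof (rule bij_betw_byWitness[where f' = ?glue])
    show "\<forall>f\<in>{f \<in> \<Union>P \<rightarrow>\<^sub>E C. \<forall>W\<in>P. Q W f}. ?glue (\<lambda>W\<in>P. restrict f W) = f"
    proof
      fix f assume f: "f \<in> {f \<in> \<Union>P \<rightarrow>\<^sub>E C. \<forall>W\<in>P. Q W f}"
      show "?glue (\<lambda>W\<in>P. restrict f W) = f"
      proof
        fix y show "?glue (\<lambda>W\<in>P. restrict f W) y = f y"
        proof (cases "y \<in> \<Union>P")
          case True
          then obtain W where "W \<in> P" "y \<in> W" by blast
          then show ?thesis by (subst glue[of W]) auto
        next
          case False
          then show ?thesis using f by (auto simp: PiE_def extensional_def)
        qed
      qed
    qed
    show "\<forall>F\<in>?T. (\<lambda>W\<in>P. restrict (?glue F) W) = F"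
    proof
      fix F assume F: "F \<in> ?T"
      define G where "G = ?glue F"
      have G: "G y = F W y" if "W \<in> P" "y \<in> W" for W y
        unfolding G_def by (rule glue[OF that])
      have "restrict G W = F W" if "W \<in> P" for W
      proof
        fix y
        have "F W \<in> {f \<in> W \<rightarrow>\<^sub>E C. Q W f}" by (rule PiE_mem[OF F that])
        then have "F W y = undefined" if "y \<notin> W" using that PiE_arb[of "F W" W "\<lambda>_. C" y] by simp
        then show "restrict G W y = F W y"
          by (cases "y \<in> W") (simp_all add: G[OF that])
      qed
      then have "(\<lambda>W\<in>P. restrict G W) = (\<lambda>W\<in>P. F W)" by (intro restrict_ext)
      also have "\<dots> = F" by (rule PiE_restrict[OF F])
      finally show "(\<lambda>W\<in>P. restrict (?glue F) W) = F" unfolding G_def .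
    qed
    show "(\<lambda>f. \<lambda>W\<in>P. restrict f W) ` {f \<in> \<Union>P \<rightarrow>\<^sub>E C. \<forall>W\<in>P. Q W f} \<subseteq> ?T"
    proof (intro image_subsetI PiE_I)
      fix f W assume f: "f \<in> {f \<in> \<Union>P \<rightarrow>\<^sub>E C. \<forall>W\<in>P. Q W f}" and W: "W \<in> P"
      then have "f y \<in> C" if "y \<in> W" for y using that by auto
      then show "(\<lambda>W\<in>P. restrict f W) W \<in> {f \<in> W \<rightarrow>\<^sub>E C. Q W f}"
        using W f by (simp add: restr PiE_iff)
    qed simp
    show "?glue ` ?T \<subseteq> {f \<in> \<Union>P \<rightarrow>\<^sub>E C. \<forall>W\<in>P. Q W f}"
    proof clarify
      fix F assume F: "F \<in> ?T"
      have "?glue F \<in> \<Union>P \<rightarrow>\<^sub>E C"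
      proof (rule PiE_I)
        fix y assume "y \<in> \<Union>P"
        then obtain W where W: "W \<in> P" "y \<in> W" by blast
        then have "F W \<in> W \<rightarrow>\<^sub>E C" using F by auto
        then show "?glue F y \<in> C" using W by (subst glue[OF W]) auto
      qed simp
      moreover have "\<forall>W\<in>P. Q W (?glue F)" using F glueQ by auto
      ultimately show "?glue F \<in> \<Union>P \<rightarrow>\<^sub>E C \<and> (\<forall>W\<in>P. Q W (?glue F))" ..
    qed
  qed
  then show ?thesis using assms(1) by (simp add: bij_betw_same_card card_PiE)
qed

lemma card_PiE_if:
  assumes "finite A" "finite R" "A \<inter> R = {}"
  shows "card (\<Pi>\<^sub>E y\<in>A \<union> R. if y \<in> A then E y else D y) = (\<Prod>y\<in>A. card (E y)) * (\<Prod>y\<in>R. card (D y))"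
proof -
  have "(\<Prod>y\<in>R. card (if y \<in> A then E y else D y)) = (\<Prod>y\<in>R. card (D y))"
    using assms(3) by (intro prod.cong) auto
  then show ?thesis using assms by (simp add: card_PiE prod.union_disjoint)
qed

definition no_descent :: "'b \<Rightarrow> 'b \<Rightarrow> 'a::linorder set \<Rightarrow> ('a \<Rightarrow> 'b) \<Rightarrow> bool" where
  "no_descent \<alpha> \<beta> A f \<longleftrightarrow> (\<forall>x\<in>A. \<forall>y\<in>A. x < y \<longrightarrow> f x = \<alpha> \<longrightarrow> f y \<noteq> \<beta>)"

lemma no_descent_subset: "no_descent \<alpha> \<beta> B f \<Longrightarrow> A \<subseteq> B \<Longrightarrow> no_descent \<alpha> \<beta> A f"
  unfolding no_descent_def by blast

section \<open>Colourings with a descent condition on \<open>A\<close> and prescribed colour lists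
  on \<open>R\<close>\<close>

context
  fixes A R :: "'a::linorder set" and C :: "'b set" and D :: "'a \<Rightarrow> 'b set" and \<alpha> \<beta> :: 'b
  assumes fin: "finite A" "finite R" and disj: "A \<inter> R = {}"
    and C: "finite C" "\<alpha> \<in> C" "\<beta> \<in> C" "\<alpha> \<noteq> \<beta>" and finD: "\<And>y. y \<in> R \<Longrightarrow> finite (D y)"
begin

lemma card_colourings_without:
  "card {f \<in> \<Pi>\<^sub>E y\<in>A \<union> R. if y \<in> A then C else D y. \<forall>x\<in>A. f x \<noteq> \<alpha>} =
    (card C - 1) ^ card A * (\<Prod>y\<in>R. card (D y))"
proof -
  have "{f \<in> \<Pi>\<^sub>E y\<in>A \<union> R. if y \<in> A then C else D y. \<forall>x\<in>A. f x \<noteq> \<alpha>}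
      = (\<Pi>\<^sub>E y\<in>A \<union> R. if y \<in> A then C - {\<alpha>} else D y)"
    by (rule set_eqI) (auto simp: PiE_iff extensional_def split: if_splits)
  then show ?thesis using C by (simp add: card_PiE_if fin disj)
qed

text \<open>Given the first \<open>\<alpha>\<close> in \<open>A\<close>, the colour \<open>\<alpha>\<close> is forbidden before it and \<open>\<beta>\<close> after it.\<close>

lemma card_colourings_with:
  "card {f \<in> \<Pi>\<^sub>E y\<in>A \<union> R. if y \<in> A then C else D y. (\<exists>x\<in>A. f x = \<alpha>) \<and> no_descent \<alpha> \<beta> A f} =
    card A * (card C - 1) ^ (card A - 1) * (\<Prod>y\<in>R. card (D y))"
proof -
  let ?E = "\<lambda>x y. if y < x then C - {\<alpha>} else if y = x then {\<alpha>} else C - {\<beta>}"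
  let ?S = "\<lambda>x. \<Pi>\<^sub>E y\<in>A \<union> R. if y \<in> A then ?E x y else D y"
  have mem_E: "f y \<in> ?E x y" if f: "f \<in> ?S x" and y: "y \<in> A" for f x y
  proof -
    have "y \<in> A \<union> R" using y by simp
    from PiE_mem[OF f this] y show ?thesis by (simp only: if_True)
  qed
  have "{f \<in> \<Pi>\<^sub>E y\<in>A \<union> R. if y \<in> A then C else D y. (\<exists>x\<in>A. f x = \<alpha>) \<and> no_descent \<alpha> \<beta> A f}
      = (\<Union>x\<in>A. ?S x)" (is "?L = _")
  proof (intro equalityI subsetI)
    fix f assume f: "f \<in> ?L"
    let ?x = "Min {x \<in> A. f x = \<alpha>}"
    have fin': "finite {x \<in> A. f x = \<alpha>}" and ne: "{x \<in> A. f x = \<alpha>} \<noteq> {}" using f fin by auto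
    have x: "?x \<in> A" "f ?x = \<alpha>" using Min_in[OF fin' ne] by auto
    have before: "f y \<noteq> \<alpha>" if "y \<in> A" "y < ?x" for y
      using that Min_le[OF fin', of y] by auto
    have after: "f y \<noteq> \<beta>" if "y \<in> A" "?x < y" for y
      using that x f by (auto simp: no_descent_def)
    have "f \<in> ?S ?x"
    proof (rule PiE_I)
      fix y assume y: "y \<in> A \<union> R"
      have "f \<in> (\<Pi>\<^sub>E y\<in>A \<union> R. if y \<in> A then C else D y)" using f by simp
      from PiE_mem[OF this y] have fy: "f y \<in> (if y \<in> A then C else D y)" .
      consider "y \<notin> A" | "y \<in> A" "y < ?x" | "y \<in> A" "y = ?x" | "y \<in> A" "?x < y"
        by (meson not_less_iff_gr_or_eq)
      then show "f y \<in> (if y \<in> A then ?E ?x y else D y)"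
      proof cases
        case 1 then show ?thesis using fy by simp
      next
        case 2 then show ?thesis using fy before[of y] by auto
      next
        case 3 then show ?thesis using x by simp
      next
        case 4 then show ?thesis using fy after[of y] by auto
      qed
    qed (use f in \<open>auto simp: PiE_def extensional_def\<close>)
    then show "f \<in> (\<Union>x\<in>A. ?S x)" using x by blast
  next
    fix f assume "f \<in> (\<Union>x\<in>A. ?S x)"
    then obtain x where x: "x \<in> A" and f: "f \<in> ?S x" by blast
    note val = mem_E[OF f]
    have fx: "f x = \<alpha>" using val[OF x] by simp
    have "f \<in> (\<Pi>\<^sub>E y\<in>A \<union> R. if y \<in> A then C else D y)"
      using f C by (rule_tac subsetD[OF PiE_mono]) (auto split: if_splits)
    \<comment> \<open>No \<alpha> occurs before \<open>x\<close>, so an element of colour \<alpha>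
      with a successor \<open>z\<close> forces \<open>x < z\<close>, and beyond \<open>x\<close> the
      colour \<beta> is excluded.\<close>
    moreover have "no_descent \<alpha> \<beta> A f"
      unfolding no_descent_def
    proof (intro ballI impI)
      fix y z assume yz: "y \<in> A" "z \<in> A" "y < z" "f y = \<alpha>"
      then have "\<not> y < x" using val[of y] by auto
      then have "x < z" using yz by auto
      then show "f z \<noteq> \<beta>" using val[of z] yz by (auto split: if_splits)
    qed
    ultimately show "f \<in> ?L" using x fx by auto
  qed
  moreover have "card (\<Union>x\<in>A. ?S x) = (\<Sum>x\<in>A. card (?S x))"
  proof (rule card_UN_disjoint)
    show "\<forall>x\<in>A. finite (?S x)"
      using fin C finD by (auto intro!: finite_PiE)
    \<comment> \<open>If \<open>x < y\<close>, membership in \<open>?S y\<close> forbids at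
      \<open>x\<close> the colour \<alpha> that \<open>?S x\<close> prescribes there.\<close>
    show "\<forall>x\<in>A. \<forall>y\<in>A. x \<noteq> y \<longrightarrow> ?S x \<inter> ?S y = {}"
    proof (intro ballI impI equals0I)
      fix x y f assume xy: "x \<in> A" "y \<in> A" "x \<noteq> y" and f: "f \<in> ?S x \<inter> ?S y"
      then have "f x = \<alpha>" "f y = \<alpha>" using mem_E[of f x x] mem_E[of f y y] by simp_all
      then have "\<not> x < y" "\<not> y < x" using mem_E[of f y x] mem_E[of f x y] f xy by auto
      then show False using xy by simp
    qed
  qed (use fin in auto)
  moreover have "card (?S x) = (card C - 1) ^ (card A - 1) * (\<Prod>y\<in>R. card (D y))" if "x \<in> A" for x
  proof -
    have "(\<Prod>y\<in>A. card (?E x y)) = card (?E x x) * (\<Prod>y\<in>A - {x}. card (?E x y))"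
      using fin that by (intro prod.remove) auto
    \<comment> \<open>Exactly one colour is forbidden on either side of \<open>x\<close>, so the
      count does not depend on the position of the first \<alpha>.\<close>
    also have "(\<Prod>y\<in>A - {x}. card (?E x y)) = (\<Prod>y\<in>A - {x}. card C - 1)"
      using C by (intro prod.cong) auto
    finally have "(\<Prod>y\<in>A. card (?E x y)) = (card C - 1) ^ (card A - 1)"
      using that fin by simp
    then show ?thesis by (simp add: card_PiE_if fin disj)
  qed
  ultimately show ?thesis by simp
qed

text \<open>Without \<alpha> on \<open>A\<close> the descent condition is vacuous; hence the two
  preceding counts add up.\<close>

lemma card_colourings_no_descent:
  "card {f \<in> \<Pi>\<^sub>E y\<in>A \<union> R. if y \<in> A then C else D y. no_descent \<alpha> \<beta> A f} =
    ((card C - 1) ^ card A + card A * (card C - 1) ^ (card A - 1)) * (\<Prod>y\<in>R. card (D y))"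
proof -
  let ?F = "\<Pi>\<^sub>E y\<in>A \<union> R. if y \<in> A then C else D y"
  have "finite ?F" using fin C finD by (auto intro!: finite_PiE)
  moreover have "{f \<in> ?F. no_descent \<alpha> \<beta> A f} = {f \<in> ?F. \<forall>x\<in>A. f x \<noteq> \<alpha>}
      \<union> {f \<in> ?F. (\<exists>x\<in>A. f x = \<alpha>) \<and> no_descent \<alpha> \<beta> A f}"
    by (auto simp: no_descent_def)
  ultimately have "card {f \<in> ?F. no_descent \<alpha> \<beta> A f} = card {f \<in> ?F. \<forall>x\<in>A. f x \<noteq> \<alpha>}
      + card {f \<in> ?F. (\<exists>x\<in>A. f x = \<alpha>) \<and> no_descent \<alpha> \<beta> A f}"
    by (simp only:) (intro card_Un_disjoint, auto)
  then show ?thesis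
    by (simp add: card_colourings_with card_colourings_without algebra_simps)
qed

end

section \<open>Blockwise form of avoidance\<close>

text \<open>Here \<open>j\<close> plays the last element of colour \<open>\<alpha>\<close> and \<open>i\<close> the last one outside the block of \<open>j\<close>:
  the pattern can be completed to the right of \<open>y\<close> iff \<open>y < i\<close> within the block of \<open>j\<close>, and iff
  \<open>y < j\<close> within any other block.\<close>

definition block_ok :: "nat \<Rightarrow> nat \<Rightarrow> nat \<Rightarrow> nat \<Rightarrow> nat set \<Rightarrow> (nat \<Rightarrow> nat) \<Rightarrow> bool" where
  "block_ok \<alpha> \<beta> i j W f \<longleftrightarrow>
    (i \<in> W \<longrightarrow> j \<notin> W \<and> f i = \<alpha>) \<and> (j \<in> W \<longrightarrow> f j = \<alpha>) \<and> (\<forall>y\<in>W. j < y \<longrightarrow> f y \<noteq> \<alpha>) \<and>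
    (if j \<in> W then no_descent \<alpha> \<beta> (W \<inter> {..<i}) f
     else (\<forall>y\<in>W. i < y \<longrightarrow> f y \<noteq> \<alpha>) \<and> no_descent \<alpha> \<beta> (W \<inter> {..<j}) f)"

definition block_count :: "nat \<Rightarrow> nat \<Rightarrow> nat \<Rightarrow> nat \<Rightarrow> nat \<Rightarrow> nat set \<Rightarrow> nat" where
  "block_count \<alpha> \<beta> c i j W = card {f \<in> W \<rightarrow>\<^sub>E {1..c}. block_ok \<alpha> \<beta> i j W f}"

text \<open>The bracket of the counting formula: by \<open>card_colourings_no_descent\<close>, the
  number of colourings of \<open>a\<close> ordered elements in which no \<alpha> precedes a
  \<beta>.\<close>

definition descent_free :: "nat \<Rightarrow> nat \<Rightarrow> nat" where
  "descent_free c a = (c - 1) ^ a + a * (c - 1) ^ (a - 1)"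

lemma block_count_both:
  assumes "i \<in> W" "j \<in> W"
  shows "block_count \<alpha> \<beta> c i j W = 0"
  using assms by (simp add: block_count_def block_ok_def)

section \<open>Weights of the block of \<open>j\<close>, of the block of \<open>i\<close> and of the
  remaining blocks\<close>

context
  fixes \<alpha> \<beta> c i j :: nat
  assumes c: "c \<ge> 2" and \<alpha>: "\<alpha> \<in> {1..c}" and \<beta>: "\<beta> \<in> {1..c}" and neq: "\<alpha> \<noteq> \<beta>" and ij: "i < j"
begin

lemma card_colours [simp]: "card ({Suc 0..c} - {\<alpha>}) = c - Suc 0" "card ({Suc 0..c} - {\<alpha>, \<beta>}) = c - 2"
  using \<alpha> \<beta> neq by (auto simp: card_Diff_subset)

lemma prod_split_at:
  assumes "finite S" "j \<notin> S"
  shows "(\<Prod>y\<in>S \<inter> {i<..}. if y < j then x else z) = x ^ card (S \<inter> {i<..<j}) * z ^ card (S \<inter> {j<..})"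
proof -
  have "S \<inter> {i<..} = S \<inter> {i<..<j} \<union> S \<inter> {j<..}"
    using assms ij by (auto simp: not_less_iff_gr_or_eq)
  moreover have "(\<Prod>y\<in>S \<inter> {i<..<j} \<union> S \<inter> {j<..}. if y < j then x else z) =
    (\<Prod>y\<in>S \<inter> {i<..<j}. if y < j then x else z) * (\<Prod>y\<in>S \<inter> {j<..}. if y < j then x else z)"
    using assms by (intro prod.union_disjoint) auto
  ultimately show ?thesis by simp
qed

text \<open>Left of \<open>i\<close> the descent condition gives \<open>descent_free\<close>.
  Between \<open>i\<close> and \<open>j\<close> all \<open>c\<close> colours are allowed, since
  every \<alpha> beyond \<open>i\<close> lies in this same block and completes no pattern. Right of
  \<open>j\<close> only \<alpha> is excluded.\<close>

lemma block_count_j: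
  assumes S: "finite S" "i \<notin> S" "j \<notin> S"
  shows "block_count \<alpha> \<beta> c i j (insert j S) =
    descent_free c (card (S \<inter> {..<i})) * c ^ card (S \<inter> {i<..<j}) * (c - 1) ^ card (S \<inter> {j<..})"
proof -
  let ?A = "S \<inter> {..<i}" and ?R = "insert j (S \<inter> {i<..})"
  let ?D = "\<lambda>y. if y = j then {\<alpha>} else if y < j then {1..c} else {1..c} - {\<alpha>}"
  have W: "insert j S = ?A \<union> ?R" using S by (auto simp: not_less_iff_gr_or_eq)
  have "{f \<in> insert j S \<rightarrow>\<^sub>E {1..c}. block_ok \<alpha> \<beta> i j (insert j S) f} =
      {f \<in> \<Pi>\<^sub>E y\<in>?A \<union> ?R. if y \<in> ?A then {1..c} else ?D y. no_descent \<alpha> \<beta> ?A f}" (is "?L = ?Q")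
  proof -
    have "insert j S \<inter> {..<i} = ?A" using ij by auto
    then have *: "block_ok \<alpha> \<beta> i j (insert j S) f \<longleftrightarrow>
      f j = \<alpha> \<and> (\<forall>y\<in>S. j < y \<longrightarrow> f y \<noteq> \<alpha>) \<and> no_descent \<alpha> \<beta> ?A f" for f
      using S ij by (auto simp: block_ok_def)
    have F: "f \<in> (\<Pi>\<^sub>E y\<in>?A \<union> ?R. if y \<in> ?A then {1..c} else ?D y) \<longleftrightarrow>
      f \<in> insert j S \<rightarrow>\<^sub>E {1..c} \<and> f j = \<alpha> \<and> (\<forall>y\<in>S. j < y \<longrightarrow> f y \<noteq> \<alpha>)" for f
    proof -
      have "(\<Pi>\<^sub>E y\<in>?A \<union> ?R. if y \<in> ?A then {1..c} else ?D y) =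
          (\<Pi>\<^sub>E y\<in>insert j S. if y = j then {\<alpha>} else if j < y then {1..c} - {\<alpha>} else {1..c})"
        unfolding W[symmetric] using S ij by (intro PiE_cong) (auto simp: not_less_iff_gr_or_eq)
      moreover have "(\<forall>y\<in>S. f y \<in> (if y = j then {\<alpha>} else if j < y then {1..c} - {\<alpha>} else {1..c})) \<longleftrightarrow>
          (\<forall>y\<in>S. f y \<in> {1..c} \<and> (j < y \<longrightarrow> f y \<noteq> \<alpha>))"
        using S by (intro ball_cong) auto
      ultimately show ?thesis using \<alpha> by (simp add: PiE_iff) blast
    qed
    show ?thesis by (rule set_eqI) (simp only: mem_Collect_eq * F conj_assoc)
  qed
  then have "block_count \<alpha> \<beta> c i j (insert j S) = descent_free c (card ?A) * (\<Prod>y\<in>?R. card (?D y))"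
    unfolding block_count_def descent_free_def
    by (simp only:) (subst card_colourings_no_descent, use S ij \<alpha> \<beta> neq in auto)
  also have "(\<Prod>y\<in>?R. card (?D y)) = (\<Prod>y\<in>S \<inter> {i<..}. card (?D y))"
    using S by simp
  also have "\<dots> = (\<Prod>y\<in>S \<inter> {i<..}. if y < j then c else c - 1)"
    using S by (intro prod.cong) auto
  finally show ?thesis using S by (simp add: prod_split_at mult_ac)
qed

text \<open>Between \<open>i\<close> and \<open>j\<close> two colours are lost: \<alpha> because
  \<open>i\<close> is the last one outside the block of \<open>j\<close>, and \<beta> because
  \<open>i\<close> itself would be the \<alpha> before it. Right of \<open>j\<close> only \<alpha>
  is excluded.\<close>

lemma block_count_i:
  assumes S: "finite S" "i \<notin> S" "j \<notin> S"
  shows "block_count \<alpha> \<beta> c i j (insert i S) =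
    descent_free c (card (S \<inter> {..<i})) * (c - 2) ^ card (S \<inter> {i<..<j}) * (c - 1) ^ card (S \<inter> {j<..})"
proof -
  let ?A = "S \<inter> {..<i}" and ?R = "insert i (S \<inter> {i<..})"
  let ?D = "\<lambda>y. if y = i then {\<alpha>} else if y < j then {1..c} - {\<alpha>, \<beta>} else {1..c} - {\<alpha>}"
  have W: "insert i S = ?A \<union> ?R" using S by (auto simp: not_less_iff_gr_or_eq)
  have "{f \<in> insert i S \<rightarrow>\<^sub>E {1..c}. block_ok \<alpha> \<beta> i j (insert i S) f} =
      {f \<in> \<Pi>\<^sub>E y\<in>?A \<union> ?R. if y \<in> ?A then {1..c} else ?D y. no_descent \<alpha> \<beta> ?A f}" (is "?L = ?Q")
  proof -
    have *: "block_ok \<alpha> \<beta> i j (insert i S) f \<longleftrightarrow>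
      f i = \<alpha> \<and> (\<forall>y\<in>S. i < y \<longrightarrow> f y \<noteq> \<alpha>) \<and> (\<forall>y\<in>S. i < y \<and> y < j \<longrightarrow> f y \<noteq> \<beta>) \<and>
      no_descent \<alpha> \<beta> ?A f" for f
    proof
      assume ok: "block_ok \<alpha> \<beta> i j (insert i S) f"
      then have "no_descent \<alpha> \<beta> (insert i S \<inter> {..<j}) f" using S ij by (auto simp: block_ok_def)
      then have "no_descent \<alpha> \<beta> ?A f" and "\<forall>y\<in>S. i < y \<and> y < j \<longrightarrow> f i = \<alpha> \<longrightarrow> f y \<noteq> \<beta>"
        using ij by (auto elim: no_descent_subset) (auto simp: no_descent_def)
      with ok show "f i = \<alpha> \<and> (\<forall>y\<in>S. i < y \<longrightarrow> f y \<noteq> \<alpha>) \<and> (\<forall>y\<in>S. i < y \<and> y < j \<longrightarrow> f y \<noteq> \<beta>) \<and>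
        no_descent \<alpha> \<beta> ?A f"
        using S ij by (auto simp: block_ok_def)
    next
      assume R: "f i = \<alpha> \<and> (\<forall>y\<in>S. i < y \<longrightarrow> f y \<noteq> \<alpha>) \<and> (\<forall>y\<in>S. i < y \<and> y < j \<longrightarrow> f y \<noteq> \<beta>) \<and>
        no_descent \<alpha> \<beta> ?A f"
      \<comment> \<open>Before \<open>i\<close> the condition on \<open>?A\<close> applies,
        \<open>i\<close> has colour \<alpha>, and between \<open>i\<close> and \<open>j\<close> the
        colour \<beta> is excluded outright.\<close>
      have "f y \<noteq> \<beta>" if "x \<in> insert i S" "y \<in> insert i S" "x < y" "y < j" "f x = \<alpha>" for x y
      proof -
        consider "y < i" | "y = i" | "i < y" by linarith
        then show ?thesis using R that neq by cases (auto simp: no_descent_def)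
      qed
      then have "no_descent \<alpha> \<beta> (insert i S \<inter> {..<j}) f" by (auto simp: no_descent_def)
      then show "block_ok \<alpha> \<beta> i j (insert i S) f"
        using R S ij by (auto simp: block_ok_def)
    qed
    have F: "f \<in> (\<Pi>\<^sub>E y\<in>?A \<union> ?R. if y \<in> ?A then {1..c} else ?D y) \<longleftrightarrow>
      f \<in> insert i S \<rightarrow>\<^sub>E {1..c} \<and> f i = \<alpha> \<and> (\<forall>y\<in>S. i < y \<longrightarrow> f y \<noteq> \<alpha>) \<and>
        (\<forall>y\<in>S. i < y \<and> y < j \<longrightarrow> f y \<noteq> \<beta>)" for f
    proof -
      have "(\<Pi>\<^sub>E y\<in>?A \<union> ?R. if y \<in> ?A then {1..c} else ?D y) =
          (\<Pi>\<^sub>E y\<in>insert i S. if i < y then if y < j then {1..c} - {\<alpha>, \<beta>} else {1..c} - {\<alpha>}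
            else if y = i then {\<alpha>} else {1..c})"
        unfolding W[symmetric] using S ij by (intro PiE_cong) (auto simp: not_less_iff_gr_or_eq)
      moreover have "(\<forall>y\<in>S. f y \<in> (if i < y then if y < j then {1..c} - {\<alpha>, \<beta>} else {1..c} - {\<alpha>}
            else if y = i then {\<alpha>} else {1..c})) \<longleftrightarrow>
          (\<forall>y\<in>S. f y \<in> {1..c} \<and> (i < y \<longrightarrow> f y \<noteq> \<alpha>) \<and> (i < y \<and> y < j \<longrightarrow> f y \<noteq> \<beta>))"
        using S by (intro ball_cong) auto
      ultimately show ?thesis using \<alpha> by (simp add: PiE_iff) blast
    qed
    show ?thesis by (rule set_eqI) (simp only: mem_Collect_eq * F conj_assoc)
  qed
  then have "block_count \<alpha> \<beta> c i j (insert i S) = descent_free c (card ?A) * (\<Prod>y\<in>?R. card (?D y))"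
    unfolding block_count_def descent_free_def
    by (simp only:) (subst card_colourings_no_descent, use S ij \<alpha> \<beta> neq in auto)
  also have "(\<Prod>y\<in>?R. card (?D y)) = (\<Prod>y\<in>S \<inter> {i<..}. card (?D y))"
    using S by simp
  also have "\<dots> = (\<Prod>y\<in>S \<inter> {i<..}. if y < j then c - 2 else c - 1)"
    using S by (intro prod.cong) auto
  finally show ?thesis using S by (simp add: prod_split_at mult_ac)
qed

text \<open>Either \<alpha> is absent, leaving \<open>c - 1\<close> colours everywhere, or its first
  occurrence \<open>x\<close> lies before \<open>i\<close> and \<beta> is also excluded between
  \<open>i\<close> and \<open>j\<close>. The sum over \<open>x\<close> is the shape required by
  \<open>partition_sum_optional_roots\<close>, with \<open>x\<close> as root.\<close>

lemma block_count_other: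
  assumes W: "finite W" "i \<notin> W" "j \<notin> W"
  shows "block_count \<alpha> \<beta> c i j W = (\<Prod>y\<in>W. c - 1) +
    (\<Sum>x\<in>W \<inter> {..<i}. \<Prod>y\<in>W - {x}. if i < y \<and> y < j then c - 2 else c - 1)"
proof -
  let ?A = "W \<inter> {..<i}" and ?R = "W \<inter> {i<..}"
  let ?D = "\<lambda>y. {1..c} - {\<alpha>}"
  let ?D' = "\<lambda>y. if y < j then {1..c} - {\<alpha>, \<beta>} else {1..c} - {\<alpha>}"
  let ?F = "\<lambda>D. \<Pi>\<^sub>E y\<in>?A \<union> ?R. if y \<in> ?A then {1..c} else D y"
  have WW: "W = ?A \<union> ?R" using W by (auto simp: not_less_iff_gr_or_eq)
  \<comment> \<open>With no \<alpha> beyond \<open>i\<close>, an \<alpha> of the block lies in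
    \<open>?A\<close> and so precedes all of \<open>?R\<close>; a single one rules out \<beta> on
    \<open>?R\<close> up to \<open>j\<close>.\<close>
  have nd: "no_descent \<alpha> \<beta> (W \<inter> {..<j}) f \<longleftrightarrow>
      (\<forall>x\<in>?A. f x \<noteq> \<alpha>) \<or> ((\<exists>x\<in>?A. f x = \<alpha>) \<and> no_descent \<alpha> \<beta> ?A f \<and> (\<forall>y\<in>?R. y < j \<longrightarrow> f y \<noteq> \<beta>))"
    if "\<forall>y\<in>W. i < y \<longrightarrow> f y \<noteq> \<alpha>" for f
  proof
    assume nd: "no_descent \<alpha> \<beta> (W \<inter> {..<j}) f"
    then have "no_descent \<alpha> \<beta> ?A f" using ij by (auto elim: no_descent_subset)
    moreover have "f y \<noteq> \<beta>" if "x \<in> ?A" "f x = \<alpha>" "y \<in> ?R" "y < j" for x y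
    proof -
      have "x \<in> W \<inter> {..<j}" "y \<in> W \<inter> {..<j}" "x < y" using that ij by auto
      from nd[unfolded no_descent_def, rule_format, OF this] that show ?thesis by simp
    qed
    ultimately show "(\<forall>x\<in>?A. f x \<noteq> \<alpha>) \<or>
        ((\<exists>x\<in>?A. f x = \<alpha>) \<and> no_descent \<alpha> \<beta> ?A f \<and> (\<forall>y\<in>?R. y < j \<longrightarrow> f y \<noteq> \<beta>))"
      by blast
  next
    assume R: "(\<forall>x\<in>?A. f x \<noteq> \<alpha>) \<or>
        ((\<exists>x\<in>?A. f x = \<alpha>) \<and> no_descent \<alpha> \<beta> ?A f \<and> (\<forall>y\<in>?R. y < j \<longrightarrow> f y \<noteq> \<beta>))"
    have "f y \<noteq> \<beta>" if "x \<in> W" "y \<in> W" "x < y" "y < j" "f x = \<alpha>" for x y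
    proof -
      have x: "x \<in> ?A" using that \<open>\<forall>y\<in>W. i < y \<longrightarrow> f y \<noteq> \<alpha>\<close> W by (auto simp: not_less_iff_gr_or_eq)
      have "y \<noteq> i" using that W by auto
      then consider "y < i" | "i < y" by linarith
      then show ?thesis using R that x by cases (auto simp: no_descent_def)
    qed
    then show "no_descent \<alpha> \<beta> (W \<inter> {..<j}) f" by (auto simp: no_descent_def)
  qed
  have "{f \<in> W \<rightarrow>\<^sub>E {1..c}. block_ok \<alpha> \<beta> i j W f} = {f \<in> ?F ?D. \<forall>x\<in>?A. f x \<noteq> \<alpha>} \<union>
     {f \<in> ?F ?D'. (\<exists>x\<in>?A. f x = \<alpha>) \<and> no_descent \<alpha> \<beta> ?A f}" (is "?L = ?Q1 \<union> ?Q2")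
  proof -
    have ok: "block_ok \<alpha> \<beta> i j W f \<longleftrightarrow>
      (\<forall>y\<in>W. i < y \<longrightarrow> f y \<noteq> \<alpha>) \<and> no_descent \<alpha> \<beta> (W \<inter> {..<j}) f" for f
      using W ij by (auto simp: block_ok_def)
    have D: "?F ?D = (\<Pi>\<^sub>E y\<in>W. if i < y then {1..c} - {\<alpha>} else {1..c})"
      unfolding WW[symmetric] using W by (intro PiE_cong) (auto simp: not_less_iff_gr_or_eq)
    have D': "?F ?D' = (\<Pi>\<^sub>E y\<in>W. if i < y then if y < j then {1..c} - {\<alpha>, \<beta>} else {1..c} - {\<alpha>} else {1..c})"
      unfolding WW[symmetric] using W by (intro PiE_cong) (auto simp: not_less_iff_gr_or_eq)
    have F: "f \<in> ?F ?D \<longleftrightarrow> f \<in> W \<rightarrow>\<^sub>E {1..c} \<and> (\<forall>y\<in>W. i < y \<longrightarrow> f y \<noteq> \<alpha>)" for f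
      unfolding D PiE_iff by (auto split: if_splits)
    have F': "f \<in> ?F ?D' \<longleftrightarrow> f \<in> ?F ?D \<and> (\<forall>y\<in>?R. y < j \<longrightarrow> f y \<noteq> \<beta>)" for f
      unfolding D D' PiE_iff by (auto split: if_splits)
    show ?thesis
    proof (rule set_eqI)
      fix f show "f \<in> ?L \<longleftrightarrow> f \<in> ?Q1 \<union> ?Q2"
        using nd[of f] by (simp only: Un_iff mem_Collect_eq ok F F') blast
    qed
  qed
  moreover have "card (?Q1 \<union> ?Q2) = card ?Q1 + card ?Q2"
  proof (rule card_Un_disjoint)
    show "finite ?Q1" "finite ?Q2" using W by (auto intro!: finite_Collect_conjI finite_PiE)
  qed auto
  moreover have "card ?Q1 = (\<Prod>y\<in>W. c - 1)"
  proof -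
    have "card ?Q1 = (c - 1) ^ card ?A * (c - 1) ^ card ?R"
      by (subst card_colourings_without[of ?A ?R "{1..c}" \<alpha> \<beta> ?D]) (use W \<alpha> \<beta> neq in auto)
    also have "\<dots> = (c - 1) ^ card (?A \<union> ?R)"
      using W by (subst card_Un_disjoint) (auto simp: power_add)
    finally show ?thesis by (simp flip: WW)
  qed
  moreover have "card ?Q2 = (\<Sum>x\<in>?A. \<Prod>y\<in>W - {x}. if i < y \<and> y < j then c - 2 else c - 1)"
  proof -
    \<comment> \<open>Removing \<open>x\<close> costs one factor \<open>c - 1\<close> wherever
      \<open>x\<close> lies in \<open>?A\<close>, so all summands are equal.\<close>
    have "(\<Prod>y\<in>W - {x}. if i < y \<and> y < j then c - 2 else c - 1)
        = (c - 1) ^ (card ?A - 1) * (\<Prod>y\<in>?R. card (?D' y))" if x: "x \<in> ?A" for x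
    proof -
      have "W - {x} = (?A - {x}) \<union> ?R" using x W by (auto simp: not_less_iff_gr_or_eq)
      moreover have "(\<Prod>y\<in>(?A - {x}) \<union> ?R. if i < y \<and> y < j then c - 2 else c - 1) =
        (\<Prod>y\<in>?A - {x}. if i < y \<and> y < j then c - 2 else c - 1) *
        (\<Prod>y\<in>?R. if i < y \<and> y < j then c - 2 else c - 1)"
        using W by (intro prod.union_disjoint) auto
      moreover have "(\<Prod>y\<in>?A - {x}. if i < y \<and> y < j then c - 2 else c - 1) = (\<Prod>y\<in>?A - {x}. c - 1)"
        by (intro prod.cong) auto
      moreover have "(\<Prod>y\<in>?R. if i < y \<and> y < j then c - 2 else c - 1) = (\<Prod>y\<in>?R. card (?D' y))"
        by (intro prod.cong) auto
      ultimately show ?thesis using x W by simp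
    qed
    moreover have "card ?Q2 = card ?A * (c - 1) ^ (card ?A - 1) * (\<Prod>y\<in>?R. card (?D' y))"
      by (subst card_colourings_with[of ?A ?R "{1..c}" \<alpha> \<beta> ?D']) (use W \<alpha> \<beta> neq in auto)
    ultimately show ?thesis by (simp add: mult.assoc)
  qed
  ultimately show ?thesis by (simp add: block_count_def)
qed

end

section \<open>Classification of the avoiders\<close>

text \<open>For \<open>i < j\<close> in \<open>{1..n}\<close> the conditions say blockwise that
  \<open>j\<close> is the last \<alpha>, that \<open>i\<close> is the last \<alpha> outside its
  block, and that the pattern is avoided; hence the count can factor over blocks.\<close>

definition last_pair_class :: "nat \<Rightarrow> nat \<Rightarrow> nat \<Rightarrow> nat \<Rightarrow> nat \<Rightarrow> nat \<Rightarrow> (nat set set \<times> (nat \<Rightarrow> nat)) set" where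
  "last_pair_class n c \<alpha> \<beta> i j =
    {(P, col) \<in> colored_partitions n c. \<forall>W\<in>P. block_ok \<alpha> \<beta> i j W col}"

text \<open>For a fixed partition the blockwise conditions are local, so the numbers of colourings
  of the blocks multiply.\<close>

lemma card_last_pair_class:
  "card (last_pair_class n c \<alpha> \<beta> i j) = partition_sum (block_count \<alpha> \<beta> c i j) {1..n}"
proof -
  have local: "block_ok \<alpha> \<beta> i j W f = block_ok \<alpha> \<beta> i j W g"
    if "\<And>y. y \<in> W \<Longrightarrow> f y = g y" for W f g
    using that by (auto simp: block_ok_def no_descent_def)
  let ?C = "\<lambda>P. {col \<in> {1..n} \<rightarrow>\<^sub>E {1..c}. \<forall>W\<in>P. block_ok \<alpha> \<beta> i j W col}"
  have "last_pair_class n c \<alpha> \<beta> i j = Sigma {P. partition_on {1..n} P} ?C"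
    by (auto simp: last_pair_class_def colored_partitions_def)
  moreover have "card (Sigma {P. partition_on {1..n} P} ?C) = (\<Sum>P | partition_on {1..n} P. card (?C P))"
    by (intro card_SigmaI finitely_many_partition_on) (auto intro!: finite_Collect_conjI finite_PiE)
  moreover have "card (?C P) = (\<Prod>W\<in>P. block_count \<alpha> \<beta> c i j W)" if "partition_on {1..n} P" for P
  proof -
    have P: "finite P" "disjoint P" "\<Union>P = {1..n}"
      using that finite_elements[of "{1..n}" P] by (auto simp: partition_on_def)
    have "card {f \<in> \<Union>P \<rightarrow>\<^sub>E {1..c}. \<forall>W\<in>P. block_ok \<alpha> \<beta> i j W f} =
        (\<Prod>W\<in>P. card {f \<in> W \<rightarrow>\<^sub>E {1..c}. block_ok \<alpha> \<beta> i j W f})"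
      by (rule card_colourings_blocks[OF P(1,2) local])
    then show ?thesis by (simp only: P(3) block_count_def)
  qed
  ultimately show ?thesis by (simp add: partition_sum_def)
qed

lemma partition_on_block_unique:
  "partition_on A P \<Longrightarrow> W \<in> P \<Longrightarrow> V \<in> P \<Longrightarrow> x \<in> W \<Longrightarrow> x \<in> V \<Longrightarrow> W = V"
  by (auto simp: partition_on_def disjoint_def)

text \<open>The last element \<open>z\<close> of an occurrence has colour \<alpha>, so
  \<open>z \<le> j\<close>, and even \<open>z \<le> i\<close> if the block of \<open>x\<close> and
  \<open>y\<close> contains \<open>j\<close>. Either way \<open>x\<close> and \<open>y\<close> lie
  where descents are forbidden.\<close>

lemma last_pair_class_avoids:
  assumes \<pi>: "(P, col) \<in> last_pair_class n c \<alpha> \<beta> i j"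
  shows "\<not> eq_contains_112 \<alpha> \<beta> (P, col)"
proof
  assume "eq_contains_112 \<alpha> \<beta> (P, col)"
  then obtain x y z X Z where xyz: "x < y" "y < z" "X \<in> P" "Z \<in> P" "X \<noteq> Z" "x \<in> X" "y \<in> X" "z \<in> Z"
    "col x = \<alpha>" "col y = \<beta>" "col z = \<alpha>"
    unfolding eq_contains_112_def by blast
  have P: "partition_on {1..n} P" and ok: "\<And>W. W \<in> P \<Longrightarrow> block_ok \<alpha> \<beta> i j W col"
    using \<pi> by (auto simp: last_pair_class_def colored_partitions_def)
  have zj: "z \<le> j"
    using ok[OF \<open>Z \<in> P\<close>] xyz by (auto simp: block_ok_def not_less[symmetric])
  show False
  proof (cases "j \<in> X")
    case True
    then have "j \<notin> Z" using partition_on_block_unique[OF P] xyz by blast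
    then have "z \<le> i"
      using ok[OF \<open>Z \<in> P\<close>] xyz by (auto simp: block_ok_def not_less[symmetric])
    then have "x \<in> X \<inter> {..<i}" "y \<in> X \<inter> {..<i}" using xyz by auto
    moreover have "no_descent \<alpha> \<beta> (X \<inter> {..<i}) col"
      using ok[OF \<open>X \<in> P\<close>] True by (simp add: block_ok_def)
    ultimately show False using xyz unfolding no_descent_def by blast
  next
    case False
    then have "no_descent \<alpha> \<beta> (X \<inter> {..<j}) col"
      using ok[OF \<open>X \<in> P\<close>] by (simp add: block_ok_def)
    moreover have "x \<in> X \<inter> {..<j}" "y \<in> X \<inter> {..<j}" using xyz zj by auto
    ultimately show False using xyz unfolding no_descent_def by blast
  qed
qed

text \<open>Both indices are maxima determined by the coloured partition: first \<open>j\<close>,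
  then \<open>i\<close> relative to the block of \<open>j\<close>.\<close>

lemma last_pair_class_disjoint:
  assumes "(P, col) \<in> last_pair_class n c \<alpha> \<beta> i j" and "(P, col) \<in> last_pair_class n c \<alpha> \<beta> i' j'"
    and "{i, j, i', j'} \<subseteq> {1..n}"
  shows "i = i' \<and> j = j'"
proof -
  have P: "partition_on {1..n} P" and ok: "\<And>W. W \<in> P \<Longrightarrow> block_ok \<alpha> \<beta> i j W col"
    and ok': "\<And>W. W \<in> P \<Longrightarrow> block_ok \<alpha> \<beta> i' j' W col"
    using assms by (auto simp: last_pair_class_def colored_partitions_def)
  have "\<exists>W\<in>P. x \<in> W" if "x \<in> {1..n}" for x using that P by (auto simp: partition_on_def)
  then obtain I J I' J' where W: "I \<in> P" "i \<in> I" "J \<in> P" "j \<in> J" "I' \<in> P" "i' \<in> I'" "J' \<in> P" "j' \<in> J'"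
    using assms(3) by (metis insert_subset)
  have col: "col i = \<alpha>" "col j = \<alpha>" "j \<notin> I" "col i' = \<alpha>" "col j' = \<alpha>" "j' \<notin> I'"
    using ok[of I] ok[of J] ok'[of I'] ok'[of J'] W by (auto simp: block_ok_def)
  have "\<not> j < j'" using ok[of J'] W col by (auto simp: block_ok_def)
  moreover have "\<not> j' < j" using ok'[of J] W col by (auto simp: block_ok_def)
  ultimately have j: "j = j'" by simp
  have "\<not> i < i'" using ok[of I'] W col j by (auto simp: block_ok_def)
  moreover have "\<not> i' < i" using ok'[of I] W col j by (auto simp: block_ok_def)
  ultimately show ?thesis using j by simp
qed

text \<open>Taking \<open>i\<close> and \<open>j\<close> as the maxima in question, a forbidden
  descent would be completed to the pattern by \<open>i\<close> inside the block of
  \<open>j\<close>, and by \<open>j\<close> inside any other block.\<close>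

lemma avoider_cases:
  assumes \<pi>: "(P, col) \<in> eq_avoiders_112 n c \<alpha> \<beta>"
    and some: "\<exists>x\<in>{1..n}. col x = \<alpha>" and not1: "\<not> (\<exists>X\<in>P. {x \<in> {1..n}. col x = \<alpha>} \<subseteq> X)"
  shows "\<exists>i j. 1 \<le> i \<and> i < j \<and> j \<le> n \<and> (P, col) \<in> last_pair_class n c \<alpha> \<beta> i j"
proof -
  let ?A = "{x \<in> {1..n}. col x = \<alpha>}"
  have cp: "(P, col) \<in> colored_partitions n c" and P: "partition_on {1..n} P"
    and av: "\<not> eq_contains_112 \<alpha> \<beta> (P, col)"
    using \<pi> by (auto simp: eq_avoiders_112_def colored_partitions_def)
  define j where "j = Max ?A"
  have finA: "finite ?A" and neA: "?A \<noteq> {}" using some by auto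
  have j: "j \<in> {1..n}" "col j = \<alpha>" using Max_in[OF finA neA] by (auto simp: j_def)
  have j_max: "x \<le> j" if "x \<in> {1..n}" "col x = \<alpha>" for x
    using that Max_ge[OF finA, of x] by (auto simp: j_def)
  obtain J where J: "J \<in> P" "j \<in> J" using j P unfolding partition_on_def by blast
  define i where "i = Max (?A - J)"
  \<comment> \<open>If this difference were empty, the block \<open>J\<close> would contain every
    \<alpha>, against \<open>not1\<close>.\<close>
  have finB: "finite (?A - J)" and neB: "?A - J \<noteq> {}" using not1 J by auto
  have i: "i \<in> {1..n}" "col i = \<alpha>" "i \<notin> J" using Max_in[OF finB neB] by (auto simp: i_def)
  have i_max: "x \<le> i" if "x \<in> {1..n}" "col x = \<alpha>" "x \<notin> J" for x
    using that Max_ge[OF finB, of x] by (auto simp: i_def)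
  obtain I where I: "I \<in> P" "i \<in> I" using i P unfolding partition_on_def by blast
  have "i \<noteq> j" using i J by auto
  then have ij: "i < j" using j_max[OF i(1,2)] by simp
  have sub: "W \<subseteq> {1..n}" if "W \<in> P" for W using that P by (auto simp: partition_on_def)
  have no: "col y \<noteq> \<beta>" if "W \<in> P" "Z \<in> P" "W \<noteq> Z" "x \<in> W" "y \<in> W" "z \<in> Z" "x < y" "y < z"
    "col x = \<alpha>" "col z = \<alpha>" for W Z x y z
    using av that unfolding eq_contains_112_def by blast
  have "block_ok \<alpha> \<beta> i j W col" if W: "W \<in> P" for W
  proof (cases "j \<in> W")
    case True
    then have WJ: "W = J" using partition_on_block_unique[OF P W J(1)] J by blast
    \<comment> \<open>Here \<open>i\<close>, which lies in another block, is the third element of a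
      would-be occurrence.\<close>
    have "no_descent \<alpha> \<beta> (W \<inter> {..<i}) col"
      using no[OF W I(1) _ _ _ I(2)] i I WJ by (auto simp: no_descent_def)
    moreover have "col y \<noteq> \<alpha>" if "y \<in> W" "j < y" for y
      using j_max[of y] sub[OF W] that by auto
    ultimately show ?thesis using True i j WJ by (auto simp: block_ok_def)
  next
    case False
    \<comment> \<open>Now \<open>j\<close> is the third element.\<close>
    have "no_descent \<alpha> \<beta> (W \<inter> {..<j}) col"
      using no[OF W J(1) _ _ _ J(2)] j J False by (auto simp: no_descent_def)
    moreover have "y \<notin> J" if "y \<in> W" for y
      using partition_on_block_unique[OF P W J(1) that] J False by blast
    then have "col y \<noteq> \<alpha>" if "y \<in> W" "i < y" for y
      using i_max[of y] sub[OF W] that by auto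
    ultimately show ?thesis using False i ij by (auto simp: block_ok_def)
  qed
  then have "(P, col) \<in> last_pair_class n c \<alpha> \<beta> i j"
    using cp by (auto simp: last_pair_class_def)
  then show ?thesis using i j ij by auto
qed

section \<open>Colored partitions in which \<alpha> is absent or confined to one block\<close>

definition colour_free_class :: "nat \<Rightarrow> nat \<Rightarrow> nat \<Rightarrow> (nat set set \<times> (nat \<Rightarrow> nat)) set" where
  "colour_free_class n c \<alpha> = {(P, col) \<in> colored_partitions n c. \<forall>x\<in>{1..n}. col x \<noteq> \<alpha>}"

definition one_block_class :: "nat \<Rightarrow> nat \<Rightarrow> nat \<Rightarrow> (nat set set \<times> (nat \<Rightarrow> nat)) set" where
  "one_block_class n c \<alpha> = {(P, col) \<in> colored_partitions n c.
     (\<exists>x\<in>{1..n}. col x = \<alpha>) \<and> (\<exists>X\<in>P. {x \<in> {1..n}. col x = \<alpha>} \<subseteq> X)}"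

lemma card_colour_free_class:
  assumes "\<alpha> \<in> {1..c}"
  shows "card (colour_free_class n c \<alpha>) = Bell n * (c - 1) ^ n"
proof -
  have "colour_free_class n c \<alpha> = {P. partition_on {1..n} P} \<times> ({1..n} \<rightarrow>\<^sub>E {1..c} - {\<alpha>})"
    unfolding colour_free_class_def colored_partitions_def set_eq_iff
    by (simp add: PiE_iff split_beta) blast
  then show ?thesis
    using assms by (simp add: card_cartesian_product card_PiE Bell_def)
qed

text \<open>Such a colored partition is sorted by the block \<open>X\<close> holding all \<alpha>
  and the nonempty set \<open>J\<close> of their positions, of sizes \<open>k\<close> and
  \<open>j\<close>. The other blocks give \<open>Bell (n - k)\<close>, the other elements
  \<open>c - 1\<close> colours each.\<close>

lemma card_one_block_class:
  assumes \<alpha>: "\<alpha> \<in> {1..c}"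
  shows "card (one_block_class n c \<alpha>) =
    (\<Sum>k=1..n. \<Sum>j=1..k. (n choose k) * (k choose j) * Bell (n - k) * (c - 1) ^ (n - j))"
proof -
  let ?P = "\<lambda>X. {P. partition_on {1..n} P \<and> X \<in> P}"
  let ?C = "\<lambda>J. \<Pi>\<^sub>E y\<in>{1..n}. if y \<in> J then {\<alpha>} else {1..c} - {\<alpha>}"
  let ?I = "Sigma (Pow {1..n}) (\<lambda>X. Pow X - {{}})"
  let ?S = "\<lambda>(X, J). ?P X \<times> ?C J"
  have finI: "finite ?I" by (intro finite_SigmaI) (auto intro: finite_subset)
  have C: "col \<in> ?C J \<longleftrightarrow> col \<in> {1..n} \<rightarrow>\<^sub>E {1..c} \<and> {x \<in> {1..n}. col x = \<alpha>} = J"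
    if "J \<subseteq> {1..n}" for J col
  proof -
    have "(\<forall>y\<in>{1..n}. col y \<in> (if y \<in> J then {\<alpha>} else {1..c} - {\<alpha>})) \<longleftrightarrow>
      (\<forall>y\<in>{1..n}. col y \<in> {1..c} \<and> (col y = \<alpha> \<longleftrightarrow> y \<in> J))"
      using \<alpha> by (intro ball_cong) auto
    then show ?thesis using that unfolding PiE_iff by blast
  qed
  have "one_block_class n c \<alpha> = (\<Union>z\<in>?I. ?S z)"
  proof (intro equalityI subsetI)
    fix \<pi> assume "\<pi> \<in> one_block_class n c \<alpha>"
    then obtain P col X where \<pi>: "\<pi> = (P, col)" and P: "partition_on {1..n} P"
      and col: "col \<in> {1..n} \<rightarrow>\<^sub>E {1..c}" and ne: "\<exists>x\<in>{1..n}. col x = \<alpha>"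
      and X: "X \<in> P" "{x \<in> {1..n}. col x = \<alpha>} \<subseteq> X"
      by (auto simp: one_block_class_def colored_partitions_def)
    let ?J = "{x \<in> {1..n}. col x = \<alpha>}"
    have "(X, ?J) \<in> ?I" using P X ne by (auto simp: partition_on_def)
    moreover have "?J \<subseteq> {1..n}" by blast
    then have "col \<in> ?C ?J" using C[of ?J col] col by blast
    ultimately show "\<pi> \<in> (\<Union>z\<in>?I. ?S z)" using \<pi> P X by blast
  next
    fix \<pi> assume "\<pi> \<in> (\<Union>z\<in>?I. ?S z)"
    then obtain X J P col where \<pi>: "\<pi> = (P, col)" and XJ: "X \<subseteq> {1..n}" "J \<subseteq> X" "J \<noteq> {}"
      and P: "partition_on {1..n} P" "X \<in> P" and "col \<in> ?C J" by blast
    then have "col \<in> {1..n} \<rightarrow>\<^sub>E {1..c} \<and> {x \<in> {1..n}. col x = \<alpha>} = J"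
      using C[of J col] by blast
    then show "\<pi> \<in> one_block_class n c \<alpha>"
      using XJ P by (auto simp: one_block_class_def colored_partitions_def \<pi>)
  qed
  also have "card \<dots> = (\<Sum>z\<in>?I. card (?S z))"
  proof (rule card_UN_disjoint[OF finI])
    show "\<forall>z\<in>?I. finite (?S z)"
      by (auto intro!: finite_PiE finite_Collect_conjI finitely_many_partition_on)
    show "\<forall>z\<in>?I. \<forall>z'\<in>?I. z \<noteq> z' \<longrightarrow> ?S z \<inter> ?S z' = {}"
    proof (intro ballI impI equals0I)
      fix z z' \<pi> assume z: "z \<in> ?I" and z': "z' \<in> ?I" and "z \<noteq> z'" and \<pi>: "\<pi> \<in> ?S z \<inter> ?S z'"
      obtain X J where zX: "z = (X, J)" "X \<subseteq> {1..n}" "J \<subseteq> X" "J \<noteq> {}" using z by blast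
      obtain X' J' where zX': "z' = (X', J')" "X' \<subseteq> {1..n}" "J' \<subseteq> X'" "J' \<noteq> {}" using z' by blast
      obtain P col where Pc: "\<pi> = (P, col)" "partition_on {1..n} P" "X \<in> P" "X' \<in> P"
        "col \<in> ?C J" "col \<in> ?C J'" using \<pi> zX zX' by blast
      have "J \<subseteq> {1..n}" "J' \<subseteq> {1..n}" using zX zX' by auto
      from C[OF this(1), of col] C[OF this(2), of col] Pc(5,6) have "J = J'" by simp
      \<comment> \<open>The common set \<open>J\<close> is nonempty, so the two blocks meet and
        coincide.\<close>
      obtain x where "x \<in> X" "x \<in> X'" using zX zX' \<open>J = J'\<close> by blast
      then have "X = X'" by (rule partition_on_block_unique[OF Pc(2-4)])
      then show False using zX zX' \<open>J = J'\<close> \<open>z \<noteq> z'\<close> by simp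
    qed
  qed
  also have "\<dots> = (\<Sum>(X, J)\<in>?I. Bell (n - card X) * (c - 1) ^ (n - card J))"
  proof (intro sum.cong refl)
    fix z assume "z \<in> ?I"
    then obtain X J x where z: "z = (X, J)" and X: "X \<subseteq> {1..n}" "J \<subseteq> X" "x \<in> J" by blast
    have "card (?C J) = (\<Prod>y\<in>{1..n}. if y \<in> J then 1 else c - 1)"
      using \<alpha> by (subst card_PiE) (auto intro!: prod.cong)
    also have "\<dots> = (\<Prod>y\<in>{1..n} - J. c - 1)"
      by (intro prod.mono_neutral_cong_right) auto
    also have "\<dots> = (c - 1) ^ (n - card J)"
      using X by (simp add: card_Diff_subset finite_subset[of J "{1..n}"])
    finally have "card (?C J) = (c - 1) ^ (n - card J)" .
    moreover have "card (?P X) = Bell (n - card X)"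
      using X card_partitions_containing[of "{1..n}" X] by auto
    ultimately show "card (?S z) = (case z of (X, J) \<Rightarrow> Bell (n - card X) * (c - 1) ^ (n - card J))"
      by (simp only: z case_prod_conv card_cartesian_product)
  qed
  also have "\<dots> = (\<Sum>X\<in>Pow {1..n}. \<Sum>J\<in>Pow X - {{}}. Bell (n - card X) * (c - 1) ^ (n - card J))"
    by (intro sum.Sigma[symmetric]) (auto intro: finite_subset)
  also have "\<dots> = (\<Sum>X\<in>Pow {1..n}. \<Sum>j=1..card X. (card X choose j) * (Bell (n - card X) * (c - 1) ^ (n - j)))"
  proof (intro sum.cong refl)
    fix X assume "X \<in> Pow {1..n}"
    then have fX: "finite X" using finite_subset by auto
    \<comment> \<open>The value 0 at \<open>j = 0\<close> absorbs the exclusion of the empty set, so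
      that the sum may run over all subsets.\<close>
    let ?F = "\<lambda>j. if j = 0 then 0 else Bell (n - card X) * (c - 1) ^ (n - j)"
    have "(\<Sum>J\<in>Pow X - {{}}. Bell (n - card X) * (c - 1) ^ (n - card J)) = (\<Sum>J\<in>Pow X. ?F (card J))"
    proof (rule sum.mono_neutral_cong_left)
      show "Bell (n - card X) * (c - 1) ^ (n - card J) = ?F (card J)" if "J \<in> Pow X - {{}}" for J
        using that fX finite_subset[of J X] by auto
    qed (use fX in auto)
    also have "\<dots> = (\<Sum>j\<le>card X. (card X choose j) * ?F j)"
      using fX by (intro sum_Pow_card) auto
    also have "\<dots> = (\<Sum>j=1..card X. (card X choose j) * (Bell (n - card X) * (c - 1) ^ (n - j)))"
      by (intro sum.mono_neutral_cong_right) auto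
    finally show "(\<Sum>J\<in>Pow X - {{}}. Bell (n - card X) * (c - 1) ^ (n - card J)) =
       (\<Sum>j=1..card X. (card X choose j) * (Bell (n - card X) * (c - 1) ^ (n - j)))" .
  qed
  also have "\<dots> = (\<Sum>k\<le>n. (n choose k) * (\<Sum>j=1..k. (k choose j) * (Bell (n - k) * (c - 1) ^ (n - j))))"
    using sum_Pow_card[of "{1..n}" n "\<lambda>k. \<Sum>j=1..k. (k choose j) * (Bell (n - k) * (c - 1) ^ (n - j))"]
    by simp
  also have "\<dots> = (\<Sum>k=1..n. (n choose k) * (\<Sum>j=1..k. (k choose j) * (Bell (n - k) * (c - 1) ^ (n - j))))"
    by (intro sum.mono_neutral_right) auto
  finally show ?thesis by (simp add: sum_distrib_left mult.assoc)
qed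

text \<open>The avoiders split disjointly by whether \<alpha> occurs in no block, in exactly one
  block, or in several; in the last case the pair \<open>(i, j)\<close> refines the
  splitting.\<close>

lemma card_avoiders:
  assumes "\<alpha> \<in> {1..c}"
  shows "card (eq_avoiders_112 n c \<alpha> \<beta>) = Bell n * (c - 1) ^ n
    + (\<Sum>k=1..n. \<Sum>j=1..k. (n choose k) * (k choose j) * Bell (n - k) * (c - 1) ^ (n - j))
    + (\<Sum>(i, j)\<in>{(i, j). 1 \<le> i \<and> i < j \<and> j \<le> n}.
        partition_sum (block_count \<alpha> \<beta> c i j) {1..n})"
proof -
  let ?I = "{(i, j). 1 \<le> i \<and> i < j \<and> j \<le> n}"
  let ?N0 = "colour_free_class n c \<alpha>" and ?N1 = "one_block_class n c \<alpha>"
  let ?E = "\<lambda>(i, j). last_pair_class n c \<alpha> \<beta> i j"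
  have "finite (colored_partitions n c)"
  proof (rule finite_subset)
    show "colored_partitions n c \<subseteq> {P. partition_on {1..n} P} \<times> ({1..n} \<rightarrow>\<^sub>E {1..c})"
      by (auto simp: colored_partitions_def)
  qed (auto intro!: finite_PiE finitely_many_partition_on)
  then have fin: "finite ?N0" "finite ?N1" "\<And>z. finite (?E z)"
    by (auto intro!: finite_subset[of _ "colored_partitions n c"]
        simp: colour_free_class_def one_block_class_def last_pair_class_def)
  have finI: "finite ?I" by (rule finite_subset[of _ "{1..n} \<times> {1..n}"]) auto
  \<comment> \<open>An occurrence needs elements \<open>x\<close> and \<open>z\<close> of colour
    \<alpha> in different blocks.\<close>
  have avoid0: "\<not> eq_contains_112 \<alpha> \<beta> (P, col)" if "(P, col) \<in> ?N0 \<union> ?N1" for P col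
  proof
    assume "eq_contains_112 \<alpha> \<beta> (P, col)"
    then obtain x z X Z where xz: "X \<in> P" "Z \<in> P" "X \<noteq> Z" "x \<in> X" "z \<in> Z" "col x = \<alpha>" "col z = \<alpha>"
      unfolding eq_contains_112_def by blast
    have P: "partition_on {1..n} P" using that
      by (auto simp: colour_free_class_def one_block_class_def colored_partitions_def)
    have mem: "x \<in> {1..n}" "z \<in> {1..n}" using xz P by (auto simp: partition_on_def)
    have "(\<forall>x\<in>{1..n}. col x \<noteq> \<alpha>) \<or> (\<exists>X\<in>P. {x \<in> {1..n}. col x = \<alpha>} \<subseteq> X)"
      using that by (auto simp: colour_free_class_def one_block_class_def)
    then obtain Y where "Y \<in> P" "x \<in> Y" "z \<in> Y" using mem xz by blast
    then show False using partition_on_block_unique[OF P] xz by metis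
  qed
  have pair: "(\<exists>x\<in>{1..n}. col x = \<alpha>) \<and> \<not> (\<exists>X\<in>P. {x \<in> {1..n}. col x = \<alpha>} \<subseteq> X)"
    if E: "(P, col) \<in> last_pair_class n c \<alpha> \<beta> i j" and ij: "1 \<le> i" "i < j" "j \<le> n" for P col i j
  proof -
    have P: "partition_on {1..n} P" and ok: "\<And>W. W \<in> P \<Longrightarrow> block_ok \<alpha> \<beta> i j W col"
      using E by (auto simp: last_pair_class_def colored_partitions_def)
    have mem: "i \<in> {1..n}" "j \<in> {1..n}" using ij by auto
    then obtain I J where "I \<in> P" "i \<in> I" "J \<in> P" "j \<in> J" using P unfolding partition_on_def by blast
    then have "col i = \<alpha>" "col j = \<alpha>" using ok[of I] ok[of J] by (auto simp: block_ok_def)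
    moreover have "\<not> (i \<in> X \<and> j \<in> X)" if "X \<in> P" for X using ok[OF that] by (auto simp: block_ok_def)
    ultimately show ?thesis using mem by blast
  qed
  have "eq_avoiders_112 n c \<alpha> \<beta> = ?N0 \<union> ?N1 \<union> (\<Union>z\<in>?I. ?E z)"
  proof (intro equalityI subsetI)
    fix \<pi> assume \<pi>: "\<pi> \<in> eq_avoiders_112 n c \<alpha> \<beta>"
    obtain P col where Pc: "\<pi> = (P, col)" by (cases \<pi>)
    show "\<pi> \<in> ?N0 \<union> ?N1 \<union> (\<Union>z\<in>?I. ?E z)"
    proof (cases "\<pi> \<in> ?N0 \<union> ?N1")
      case False
      then have "\<exists>x\<in>{1..n}. col x = \<alpha>" "\<not> (\<exists>X\<in>P. {x \<in> {1..n}. col x = \<alpha>} \<subseteq> X)"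
        using \<pi> unfolding Pc by (auto simp: eq_avoiders_112_def colour_free_class_def one_block_class_def)
      from avoider_cases[OF \<pi>[unfolded Pc] this] show ?thesis unfolding Pc by fastforce
    qed simp
  next
    fix \<pi> assume \<pi>: "\<pi> \<in> ?N0 \<union> ?N1 \<union> (\<Union>z\<in>?I. ?E z)"
    obtain P col where Pc: "\<pi> = (P, col)" by (cases \<pi>)
    have "\<pi> \<in> colored_partitions n c"
      using \<pi> by (auto simp: colour_free_class_def one_block_class_def last_pair_class_def)
    moreover have "\<not> eq_contains_112 \<alpha> \<beta> \<pi>"
      using \<pi> avoid0 last_pair_class_avoids unfolding Pc by blast
    ultimately show "\<pi> \<in> eq_avoiders_112 n c \<alpha> \<beta>" by (simp add: eq_avoiders_112_def)
  qed
  moreover have "?N0 \<inter> ?N1 = {}"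
    by (auto simp: colour_free_class_def one_block_class_def)
  moreover have "(?N0 \<union> ?N1) \<inter> (\<Union>z\<in>?I. ?E z) = {}"
  proof (intro equals0I, elim IntE UN_E)
    fix \<pi> z assume \<pi>: "\<pi> \<in> ?N0 \<union> ?N1" "z \<in> ?I" "\<pi> \<in> ?E z"
    then obtain i j where z: "z = (i, j)" "1 \<le> i" "i < j" "j \<le> n" by auto
    obtain P col where Pc: "\<pi> = (P, col)" by (cases \<pi>)
    show False
      using pair[of P col i j] \<pi>(1,3) z unfolding Pc
      by (auto simp: colour_free_class_def one_block_class_def)
  qed
  moreover have "card (\<Union>z\<in>?I. ?E z) = (\<Sum>z\<in>?I. card (?E z))"
  proof (rule card_UN_disjoint[OF finI])
    show "\<forall>z\<in>?I. \<forall>z'\<in>?I. z \<noteq> z' \<longrightarrow> ?E z \<inter> ?E z' = {}"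
    proof (intro ballI impI equals0I)
      fix z z' \<pi> assume z: "z \<in> ?I" "z' \<in> ?I" "z \<noteq> z'" and \<pi>: "\<pi> \<in> ?E z \<inter> ?E z'"
      obtain i j i' j' P col where eq: "z = (i, j)" "z' = (i', j')" "\<pi> = (P, col)"
        by (cases z, cases z', cases \<pi>) blast
      have "(P, col) \<in> last_pair_class n c \<alpha> \<beta> i j" "(P, col) \<in> last_pair_class n c \<alpha> \<beta> i' j'"
        "{i, j, i', j'} \<subseteq> {1..n}"
        using z \<pi> unfolding eq by auto
      then have "i = i' \<and> j = j'" by (rule last_pair_class_disjoint)
      then show False using z eq by simp
    qed
  qed (use fin in blast)
  moreover have "(\<Sum>z\<in>?I. card (?E z)) = (\<Sum>(i, j)\<in>?I. partition_sum (block_count \<alpha> \<beta> c i j) {1..n})"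
    by (intro sum.cong refl) (auto simp: card_last_pair_class)
  ultimately show ?thesis
    using fin finI by (simp add: card_Un_disjoint card_colour_free_class[OF assms] card_one_block_class[OF assms])
qed

section \<open>Summation by block sizes\<close>

text \<open>The arguments are the numbers of elements left of \<open>i\<close>, between
  \<open>i\<close> and \<open>j\<close>, and right of \<open>j\<close> once the blocks of both are
  removed. Of the \<open>k\<close> roots' companions, \<open>p\<close> lie in the middle and
  \<open>q\<close> in the outer regions; the power of \<open>c - 1\<close> covers these
  \<open>q\<close> and the elements of \<alpha>-free blocks.\<close>

definition rest_count :: "nat \<Rightarrow> nat \<Rightarrow> nat \<Rightarrow> nat \<Rightarrow> nat \<Rightarrow> nat" where
  "rest_count n c u\<^sub>1 u\<^sub>2 u\<^sub>3 = (\<Sum>k\<le>n. \<Sum>p\<le>n. \<Sum>q\<le>n.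
    (u\<^sub>1 choose k) * (u\<^sub>2 choose p) * ((u\<^sub>1 - k + u\<^sub>3) choose q) * (c - 2) ^ p * k ^ (p + q)
    * (c - 1) ^ (u\<^sub>1 + u\<^sub>2 + u\<^sub>3 - k - p) * Bell (u\<^sub>1 + u\<^sub>2 + u\<^sub>3 - k - p - q))"

context
  fixes \<alpha> \<beta> c i j n :: nat
  assumes c: "c \<ge> 2" and \<alpha>: "\<alpha> \<in> {1..c}" and \<beta>: "\<beta> \<in> {1..c}" and neq: "\<alpha> \<noteq> \<beta>"
    and i: "1 \<le> i" and ij: "i < j" and j: "j \<le> n"
begin

text \<open>\<open>block_count_other\<close> gives exactly the optional-root weights, so
  \<open>partition_sum_optional_roots\<close> applies; the sums over \<open>K\<close> and
  \<open>M\<close> are then grouped by sizes.\<close>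

lemma partition_sum_block_count_rest:
  assumes U: "U \<subseteq> {1..n} - {i, j}"
  shows "partition_sum (block_count \<alpha> \<beta> c i j) U =
    rest_count n c (card (U \<inter> {..<i})) (card (U \<inter> {i<..<j})) (card (U \<inter> {j<..}))"
proof -
  let ?v = "\<lambda>y. if i < y \<and> y < j then c - 2 else c - 1"
  let ?u1 = "card (U \<inter> {..<i})" and ?u2 = "card (U \<inter> {i<..<j})" and ?u3 = "card (U \<inter> {j<..})"
  have fU: "finite U" using U finite_subset by blast
  have U_eq: "U = U \<inter> {..<i} \<union> U \<inter> {i<..<j} \<union> U \<inter> {j<..}"
    using U ij by (auto simp: not_less_iff_gr_or_eq)
  have cU: "card U = ?u1 + ?u2 + ?u3"
  proof -
    have "card (U \<inter> {..<i} \<union> U \<inter> {i<..<j} \<union> U \<inter> {j<..}) = ?u1 + ?u2 + ?u3"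
      using fU ij by (subst card_Un_disjoint; auto)+
    then show ?thesis using U_eq by simp
  qed
  have le: "card (U \<inter> A) \<le> n" for A
    using card_mono[of "{1..n}" "U \<inter> A"] U by auto
  have "partition_sum (block_count \<alpha> \<beta> c i j) U =
      partition_sum (\<lambda>W. (\<Prod>y\<in>W. c - 1) + (\<Sum>x\<in>W \<inter> {..<i}. \<Prod>y\<in>W - {x}. ?v y)) U"
  proof (rule partition_sum_cong)
    fix W assume "W \<subseteq> U"
    then show "block_count \<alpha> \<beta> c i j W = (\<Prod>y\<in>W. c - 1) + (\<Sum>x\<in>W \<inter> {..<i}. \<Prod>y\<in>W - {x}. ?v y)"
      using fU U c \<alpha> \<beta> neq ij by (intro block_count_other) (auto intro: finite_subset)
  qed
  also have "\<dots> = (\<Sum>K\<in>Pow (U \<inter> {..<i}). \<Sum>M\<in>Pow (U - K). (\<Prod>y\<in>M. ?v y) * card K ^ card M *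
      (\<Prod>y\<in>U - K - M. c - 1) * Bell (card (U - K - M)))"
    using fU by (rule partition_sum_optional_roots)
  also have "\<dots> = (\<Sum>K\<in>Pow (U \<inter> {..<i}). \<Sum>p\<le>n. \<Sum>q\<le>n. (?u2 choose p) * ((?u1 - card K + ?u3) choose q) *
      ((c - 2) ^ p * (c - 1) ^ q * card K ^ (p + q) *
        ((c - 1) ^ (card U - card K - (p + q)) * Bell (card U - card K - (p + q)))))"
  proof (rule sum.cong[OF refl])
    fix K assume K: "K \<in> Pow (U \<inter> {..<i})"
    \<comment> \<open>\<open>?B\<close> merges the non-roots left of \<open>i\<close> with the
      elements right of \<open>j\<close>, as both have weight \<open>c - 1\<close>; this explains
      the single binomial for \<open>q\<close>.\<close>
    let ?A = "U \<inter> {i<..<j}" and ?B = "(U \<inter> {..<i} - K) \<union> U \<inter> {j<..}"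
    let ?F = "\<lambda>p q. (c - 2) ^ p * (c - 1) ^ q * card K ^ (p + q) *
        ((c - 1) ^ (card U - card K - (p + q)) * Bell (card U - card K - (p + q)))"
    have fK: "finite K" using K fU by (auto intro: finite_subset)
    have UK: "U - K = ?A \<union> ?B" using K U ij by (auto simp: not_less_iff_gr_or_eq)
    have disj: "?A \<inter> ?B = {}" using ij by auto
    have cB: "card ?B = ?u1 - card K + ?u3"
    proof -
      have "card (U \<inter> {..<i} - K) = ?u1 - card K" using K fK by (intro card_Diff_subset) auto
      moreover have "card ?B = card (U \<inter> {..<i} - K) + ?u3"
        using fU ij by (intro card_Un_disjoint) auto
      ultimately show ?thesis by simp
    qed
    have leB: "card ?B \<le> n" using card_mono[of "{1..n}" ?B] U by auto
    have summand: "(\<Prod>y\<in>M. ?v y) * card K ^ card M * (\<Prod>y\<in>U - K - M. c - 1) * Bell (card (U - K - M))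
        = ?F (card (M \<inter> ?A)) (card (M \<inter> ?B))" if M: "M \<in> Pow (U - K)" for M
    proof -
      have fM: "finite M" using M fU by (auto intro: finite_subset)
      have M_eq: "M = (M \<inter> ?A) \<union> (M \<inter> ?B)" using M UK by auto
      have "card ((M \<inter> ?A) \<union> (M \<inter> ?B)) = card (M \<inter> ?A) + card (M \<inter> ?B)"
        using fM disj by (intro card_Un_disjoint) auto
      then have cM: "card M = card (M \<inter> ?A) + card (M \<inter> ?B)" using M_eq by simp
      have "(\<Prod>y\<in>(M \<inter> ?A) \<union> (M \<inter> ?B). ?v y) = (\<Prod>y\<in>M \<inter> ?A. ?v y) * (\<Prod>y\<in>M \<inter> ?B. ?v y)"
        using fM disj by (intro prod.union_disjoint) auto
      also have "(\<Prod>y\<in>M \<inter> ?A. ?v y) = (\<Prod>y\<in>M \<inter> ?A. c - 2)" by (intro prod.cong) auto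
      also have "(\<Prod>y\<in>M \<inter> ?B. ?v y) = (\<Prod>y\<in>M \<inter> ?B. c - 1)" using ij by (intro prod.cong) auto
      finally have "(\<Prod>y\<in>M. ?v y) = (c - 2) ^ card (M \<inter> ?A) * (c - 1) ^ card (M \<inter> ?B)"
        using M_eq by simp
      moreover have "card (U - K - M) = card U - card K - card M"
        using K M fK fM by (subst card_Diff_subset, auto)+
      ultimately show ?thesis by (simp only: prod_constant cM mult.assoc)
    qed
    have "(\<Sum>M\<in>Pow (U - K). (\<Prod>y\<in>M. ?v y) * card K ^ card M *
      (\<Prod>y\<in>U - K - M. c - 1) * Bell (card (U - K - M))) =
      (\<Sum>M\<in>Pow (?A \<union> ?B). ?F (card (M \<inter> ?A)) (card (M \<inter> ?B)))"
      using summand by (intro sum.cong) (simp_all only: UK)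
    also have "\<dots> = (\<Sum>p\<le>n. \<Sum>q\<le>n. (card ?A choose p) * (card ?B choose q) * ?F p q)"
      using fU disj le leB by (intro sum_Pow_card2) auto
    finally show "(\<Sum>M\<in>Pow (U - K). (\<Prod>y\<in>M. ?v y) * card K ^ card M *
      (\<Prod>y\<in>U - K - M. c - 1) * Bell (card (U - K - M))) =
      (\<Sum>p\<le>n. \<Sum>q\<le>n. (?u2 choose p) * ((?u1 - card K + ?u3) choose q) * ?F p q)"
      unfolding cB .
  qed
  also have "\<dots> = (\<Sum>k\<le>n. (?u1 choose k) * (\<Sum>p\<le>n. \<Sum>q\<le>n. (?u2 choose p) * ((?u1 - k + ?u3) choose q) *
      ((c - 2) ^ p * (c - 1) ^ q * k ^ (p + q) *
        ((c - 1) ^ (card U - k - (p + q)) * Bell (card U - k - (p + q))))))"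
    using fU le by (intro sum_Pow_card) auto
  also have "\<dots> = rest_count n c ?u1 ?u2 ?u3"
    unfolding rest_count_def sum_distrib_left
  proof (intro sum.cong refl)
    fix k p q
    show "(?u1 choose k) * ((?u2 choose p) * ((?u1 - k + ?u3) choose q) *
      ((c - 2) ^ p * (c - 1) ^ q * k ^ (p + q) *
        ((c - 1) ^ (card U - k - (p + q)) * Bell (card U - k - (p + q))))) =
      (?u1 choose k) * (?u2 choose p) * ((?u1 - k + ?u3) choose q) * (c - 2) ^ p * k ^ (p + q)
      * (c - 1) ^ (?u1 + ?u2 + ?u3 - k - p) * Bell (?u1 + ?u2 + ?u3 - k - p - q)"
    \<comment> \<open>Within these bounds the subtractions are exact and the two powers of
      \<open>c - 1\<close> merge; outside them a binomial is 0 on both sides.\<close>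
    proof (cases "k \<le> ?u1 \<and> p \<le> ?u2 \<and> q \<le> ?u1 - k + ?u3")
      case True
      then have "?u1 + ?u2 + ?u3 - k - p = q + (card U - k - (p + q))" using cU by linarith
      then have "(c - 1) ^ (?u1 + ?u2 + ?u3 - k - p) = (c - 1) ^ q * (c - 1) ^ (card U - k - (p + q))"
        by (simp only: power_add)
      moreover have "?u1 + ?u2 + ?u3 - k - p - q = card U - k - (p + q)" using cU by linarith
      ultimately show ?thesis by (simp only: mult_ac)
    next
      case False
      then have "(?u1 choose k) = 0 \<or> (?u2 choose p) = 0 \<or> ((?u1 - k + ?u3) choose q) = 0"
        by (auto simp: binomial_eq_0)
      then show ?thesis by auto
    qed
  qed
  finally show ?thesis .
qed

text \<open>Two applications of \<open>partition_sum_rec\<close>, first at \<open>i\<close> with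
  companions \<open>S\<close>, then at \<open>j\<close> with companions \<open>R\<close>; what
  remains contains neither and is counted by \<open>rest_count\<close>.\<close>

lemma partition_sum_block_count:
  "partition_sum (block_count \<alpha> \<beta> c i j) {1..n} =
    (\<Sum>a\<le>n. \<Sum>d\<le>n. \<Sum>f\<le>n. ((i - 1) choose a) * ((j - i - 1) choose d) * ((n - j) choose f) *
      (\<Sum>b\<le>n. \<Sum>e\<le>n. \<Sum>g\<le>n. ((i - 1 - a) choose b) * ((j - i - 1 - d) choose e) * ((n - j - f) choose g) *
        (descent_free c a * (c - 2) ^ d * (c - 1) ^ f * (descent_free c b * c ^ e * (c - 1) ^ g)
          * rest_count n c (i - 1 - a - b) (j - i - 1 - d - e) (n - j - f - g))))"
proof -
  let ?\<phi> = "block_count \<alpha> \<beta> c i j"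
  let ?V = "{1..n} - {i, j}"
  let ?V1 = "{1..<i}" and ?V2 = "{i<..<j}" and ?V3 = "{j<..n}"
  have V: "?V = ?V1 \<union> ?V2 \<union> ?V3" using i ij j by auto
  let ?H = "\<lambda>a d f b e g. descent_free c a * (c - 2) ^ d * (c - 1) ^ f * (descent_free c b * c ^ e * (c - 1) ^ g)
          * rest_count n c (i - 1 - a - b) (j - i - 1 - d - e) (n - j - f - g)"
  have "partition_sum ?\<phi> {1..n} =
      (\<Sum>S\<in>Pow ({1..n} - {i}). ?\<phi> (insert i S) * partition_sum ?\<phi> ({1..n} - insert i S))"
    using i ij j by (intro partition_sum_rec) auto
  \<comment> \<open>A block containing both \<open>i\<close> and \<open>j\<close> has weight
    0.\<close>
  also have "\<dots> = (\<Sum>S\<in>Pow ?V. ?\<phi> (insert i S) * partition_sum ?\<phi> ({1..n} - insert i S))"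
    by (rule sum.mono_neutral_right) (auto simp: block_count_both)
  also have "\<dots> = (\<Sum>S\<in>Pow (?V1 \<union> ?V2 \<union> ?V3). \<Sum>b\<le>n. \<Sum>e\<le>n. \<Sum>g\<le>n.
      ((i - 1 - card (S \<inter> ?V1)) choose b) * ((j - i - 1 - card (S \<inter> ?V2)) choose e) *
      ((n - j - card (S \<inter> ?V3)) choose g) *
      ?H (card (S \<inter> ?V1)) (card (S \<inter> ?V2)) (card (S \<inter> ?V3)) b e g)"
  proof (rule sum.cong)
    fix S assume "S \<in> Pow (?V1 \<union> ?V2 \<union> ?V3)"
    then have S: "S \<subseteq> ?V" unfolding V by simp
    then have fS: "finite S" "i \<notin> S" "j \<notin> S" by (auto intro: finite_subset)
    let ?s1 = "card (S \<inter> ?V1)" and ?s2 = "card (S \<inter> ?V2)" and ?s3 = "card (S \<inter> ?V3)"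
    have Sint: "S \<inter> {..<i} = S \<inter> ?V1" "S \<inter> {j<..} = S \<inter> ?V3" using S by auto
    have split: "?V - S = (?V1 - S) \<union> (?V2 - S) \<union> (?V3 - S)" unfolding V by auto
    have cards: "card (?V1 - S) = i - 1 - ?s1" "card (?V2 - S) = j - i - 1 - ?s2"
        "card (?V3 - S) = n - j - ?s3"
      by (auto simp: card_Diff_subset_Int Int_commute)
    have "partition_sum ?\<phi> ({1..n} - insert i S) = (\<Sum>R\<in>Pow ({1..n} - insert i S - {j}).
        ?\<phi> (insert j R) * partition_sum ?\<phi> ({1..n} - insert i S - insert j R))"
      using fS i ij j by (intro partition_sum_rec) auto
    also have "{1..n} - insert i S - {j} = ?V - S" by auto
    also have "(\<Sum>R\<in>Pow (?V - S). ?\<phi> (insert j R) * partition_sum ?\<phi> ({1..n} - insert i S - insert j R)) =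
      (\<Sum>R\<in>Pow (?V - S).
        descent_free c (card (R \<inter> (?V1 - S))) * c ^ card (R \<inter> (?V2 - S)) * (c - 1) ^ card (R \<inter> (?V3 - S)) *
        rest_count n c (i - 1 - ?s1 - card (R \<inter> (?V1 - S))) (j - i - 1 - ?s2 - card (R \<inter> (?V2 - S)))
          (n - j - ?s3 - card (R \<inter> (?V3 - S))))"
    proof (rule sum.cong[OF refl])
      fix R assume "R \<in> Pow (?V - S)"
      then have R: "R \<subseteq> ?V - S" by simp
      then have fR: "finite R" "i \<notin> R" "j \<notin> R" by (auto intro: finite_subset)
      have Rint: "R \<inter> {..<i} = R \<inter> (?V1 - S)" "R \<inter> {i<..<j} = R \<inter> (?V2 - S)"
        "R \<inter> {j<..} = R \<inter> (?V3 - S)" using R by auto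
      let ?U = "{1..n} - insert i S - insert j R"
      have Uint: "?U \<inter> {..<i} = ?V1 - S - R \<inter> (?V1 - S)" "?U \<inter> {i<..<j} = ?V2 - S - R \<inter> (?V2 - S)"
        "?U \<inter> {j<..} = ?V3 - S - R \<inter> (?V3 - S)" using i ij j by auto
      have cardU: "card (A - S - R \<inter> (A - S)) = card (A - S) - card (R \<inter> (A - S))" for A
        using fR by (intro card_Diff_subset) auto
      have "partition_sum ?\<phi> ?U =
        rest_count n c (card (?U \<inter> {..<i})) (card (?U \<inter> {i<..<j})) (card (?U \<inter> {j<..}))"
        by (intro partition_sum_block_count_rest) auto
      then show "?\<phi> (insert j R) * partition_sum ?\<phi> ?U =
        descent_free c (card (R \<inter> (?V1 - S))) * c ^ card (R \<inter> (?V2 - S)) * (c - 1) ^ card (R \<inter> (?V3 - S)) *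
        rest_count n c (i - 1 - ?s1 - card (R \<inter> (?V1 - S))) (j - i - 1 - ?s2 - card (R \<inter> (?V2 - S)))
          (n - j - ?s3 - card (R \<inter> (?V3 - S)))"
        by (simp only: block_count_j[OF c \<alpha> \<beta> neq ij fR] Uint Rint cardU cards)
    qed
    also have "\<dots> = (\<Sum>b\<le>n. \<Sum>e\<le>n. \<Sum>g\<le>n.
      (card (?V1 - S) choose b) * (card (?V2 - S) choose e) * (card (?V3 - S) choose g) *
      (descent_free c b * c ^ e * (c - 1) ^ g *
        rest_count n c (i - 1 - ?s1 - b) (j - i - 1 - ?s2 - e) (n - j - ?s3 - g)))"
      unfolding split
      by (rule sum_Pow_card3) (use i ij j cards in auto)
    finally have "partition_sum ?\<phi> ({1..n} - insert i S) = (\<Sum>b\<le>n. \<Sum>e\<le>n. \<Sum>g\<le>n.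
      ((i - 1 - ?s1) choose b) * ((j - i - 1 - ?s2) choose e) * ((n - j - ?s3) choose g) *
      (descent_free c b * c ^ e * (c - 1) ^ g *
        rest_count n c (i - 1 - ?s1 - b) (j - i - 1 - ?s2 - e) (n - j - ?s3 - g)))"
      unfolding cards .
    moreover have "?\<phi> (insert i S) = descent_free c ?s1 * (c - 2) ^ ?s2 * (c - 1) ^ ?s3"
      using block_count_i[OF c \<alpha> \<beta> neq ij fS] unfolding Sint .
    ultimately show "?\<phi> (insert i S) * partition_sum ?\<phi> ({1..n} - insert i S) =
      (\<Sum>b\<le>n. \<Sum>e\<le>n. \<Sum>g\<le>n. ((i - 1 - ?s1) choose b) * ((j - i - 1 - ?s2) choose e) *
        ((n - j - ?s3) choose g) * ?H ?s1 ?s2 ?s3 b e g)"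
      by (simp only: sum_distrib_left mult_ac)
  qed (simp only: V)
  also have "\<dots> = (\<Sum>a\<le>n. \<Sum>d\<le>n. \<Sum>f\<le>n. (card ?V1 choose a) * (card ?V2 choose d) * (card ?V3 choose f) *
      (\<Sum>b\<le>n. \<Sum>e\<le>n. \<Sum>g\<le>n. ((i - 1 - a) choose b) * ((j - i - 1 - d) choose e) * ((n - j - f) choose g) *
        ?H a d f b e g))"
    by (rule sum_Pow_card3) (use i ij j in auto)
  finally show ?thesis by simp
qed

end

section \<open>From sums over all naturals to bounded sums by block sizes\<close>

lemma Sum_any_atMost:
  fixes h :: "nat \<Rightarrow> nat"
  assumes "\<And>x. x > N \<Longrightarrow> h x = 0"
  shows "Sum_any h = (\<Sum>x\<le>N. h x)"
proof (rule Sum_any.expand_superset)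
  show "{x. h x \<noteq> 0} \<subseteq> {..N}" using assms by (auto simp: not_less[symmetric])
qed simp

text \<open>Choose \<open>x\<close> elements, then \<open>y\<close> of the rest. If
  \<open>x + y > N\<close>, one of the two binomials is 0, so no side condition arises.\<close>

lemma trinom_eq: "trinom N x y = (N choose x) * ((N - x) choose y)"
proof (cases "x + y \<le> N")
  case True
  then have "(N choose x) * ((N - x) choose y) * (fact x * fact y * fact (N - x - y)) = (fact N :: nat)"
    using binomial_fact_lemma[of x N] binomial_fact_lemma[of y "N - x"]
    by (simp add: algebra_simps)
  then have "fact N div (fact x * fact y * fact (N - x - y)) = (N choose x) * ((N - x) choose y)"
    by (metis nonzero_mult_div_cancel_right fact_nonzero mult_eq_0_iff)
  then show ?thesis using True by (simp add: trinom_def)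
next
  case False
  then show ?thesis by (auto simp: trinom_def binomial_eq_0)
qed

text \<open>Splitting off whole blocks groups the variables by block, the counting formula groups
  them by region; \<open>a\<close> and \<open>g\<close> already stand first and last.\<close>

lemma sum_reorder:
  fixes H :: "nat \<Rightarrow> nat \<Rightarrow> nat \<Rightarrow> nat \<Rightarrow> nat"
  shows "(\<Sum>d\<in>D. \<Sum>f\<in>D. \<Sum>b\<in>D. \<Sum>e\<in>D. H d f b e) = (\<Sum>b\<in>D. \<Sum>d\<in>D. \<Sum>e\<in>D. \<Sum>f\<in>D. H d f b e)"
proof -
  have "(\<Sum>d\<in>D. \<Sum>f\<in>D. \<Sum>b\<in>D. \<Sum>e\<in>D. H d f b e) = (\<Sum>d\<in>D. \<Sum>b\<in>D. \<Sum>f\<in>D. \<Sum>e\<in>D. H d f b e)"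
    by (intro sum.cong refl sum.swap)
  also have "\<dots> = (\<Sum>b\<in>D. \<Sum>d\<in>D. \<Sum>f\<in>D. \<Sum>e\<in>D. H d f b e)"
    by (rule sum.swap)
  also have "\<dots> = (\<Sum>b\<in>D. \<Sum>d\<in>D. \<Sum>e\<in>D. \<Sum>f\<in>D. H d f b e)"
    by (intro sum.cong refl sum.swap)
  finally show ?thesis .
qed

text \<open>The sum over \<open>l\<close> collapses to \<open>k ^ (p + q)\<close>, the other sums
  are cut off at \<open>n\<close>, and the summands then agree termwise up to the order of
  summation.\<close>

lemma Sum_any_eq_sums:
  fixes n c i j :: nat
  assumes i: "1 \<le> i" and ij: "i < j" and j: "j \<le> n"
  shows "(\<Sum>\<^sub>\<nat>a b. \<Sum>\<^sub>\<nat>d e. \<Sum>\<^sub>\<nat>f g. \<Sum>\<^sub>\<nat>k. \<Sum>\<^sub>\<nat>p q. \<Sum>\<^sub>\<nat>l.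
          trinom (i - 1) a b * trinom (j - i - 1) d e * trinom (n - j) f g
          * ((i - a - b - 1) choose k) * ((j - i - d - e - 1) choose p)
          * ((n + i - a - b - f - g - j - k - 1) choose q)
          * Stirling (p + q) l * falling_fact k l
          * Bell (n - a - b - d - e - f - g - k - p - q - 2)
          * ((c - 1) ^ b + b * (c - 1) ^ (b - 1))
          * ((c - 1) ^ a + a * (c - 1) ^ (a - 1))
          * (c - 2) ^ (d + p) * c ^ e
          * (c - 1) ^ (n - a - b - d - e - k - p - 2)) =
    (\<Sum>a\<le>n. \<Sum>d\<le>n. \<Sum>f\<le>n. ((i - 1) choose a) * ((j - i - 1) choose d) * ((n - j) choose f) *
      (\<Sum>b\<le>n. \<Sum>e\<le>n. \<Sum>g\<le>n. ((i - 1 - a) choose b) * ((j - i - 1 - d) choose e) * ((n - j - f) choose g) *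
        (descent_free c a * (c - 2) ^ d * (c - 1) ^ f * (descent_free c b * c ^ e * (c - 1) ^ g)
          * rest_count n c (i - 1 - a - b) (j - i - 1 - d - e) (n - j - f - g))))"
    (is "?lhs = ?rhs")
proof -
  define t where "t a b d e f g k p q =
          trinom (i - 1) a b * trinom (j - i - 1) d e * trinom (n - j) f g
          * ((i - a - b - 1) choose k) * ((j - i - d - e - 1) choose p)
          * ((n + i - a - b - f - g - j - k - 1) choose q)
          * k ^ (p + q)
          * Bell (n - a - b - d - e - f - g - k - p - q - 2)
          * descent_free c b * descent_free c a
          * (c - 2) ^ (d + p) * c ^ e
          * (c - 1) ^ (n - a - b - d - e - k - p - 2)" for a b d e f g k p q
  have el: "(\<Sum>\<^sub>\<nat>l.
          trinom (i - 1) a b * trinom (j - i - 1) d e * trinom (n - j) f g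
          * ((i - a - b - 1) choose k) * ((j - i - d - e - 1) choose p)
          * ((n + i - a - b - f - g - j - k - 1) choose q)
          * Stirling (p + q) l * falling_fact k l
          * Bell (n - a - b - d - e - f - g - k - p - q - 2)
          * ((c - 1) ^ b + b * (c - 1) ^ (b - 1))
          * ((c - 1) ^ a + a * (c - 1) ^ (a - 1))
          * (c - 2) ^ (d + p) * c ^ e
          * (c - 1) ^ (n - a - b - d - e - k - p - 2)) = t a b d e f g k p q" (is "Sum_any ?h = _")
    for a b d e f g k p q
  proof -
    have "Sum_any ?h = (\<Sum>l\<le>p + q. ?h l)" by (rule Sum_any_atMost) simp
    also have "\<dots> = (\<Sum>l\<le>p + q. (trinom (i - 1) a b * trinom (j - i - 1) d e * trinom (n - j) f g
          * ((i - a - b - 1) choose k) * ((j - i - d - e - 1) choose p)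
          * ((n + i - a - b - f - g - j - k - 1) choose q)
          * Bell (n - a - b - d - e - f - g - k - p - q - 2)
          * descent_free c b * descent_free c a
          * (c - 2) ^ (d + p) * c ^ e
          * (c - 1) ^ (n - a - b - d - e - k - p - 2)) * (Stirling (p + q) l * falling_fact k l))"
      unfolding descent_free_def by (simp only: mult_ac)
    also have "\<dots> = t a b d e f g k p q"
      unfolding sum_distrib_left[symmetric] sum_Stirling_falling_fact[OF order_refl] t_def
      by (simp only: mult_ac)
    finally show ?thesis .
  qed
  \<comment> \<open>The cut-offs proceed from the innermost variable outwards. For \<open>q\<close>,
    the inequality \<open>i < j \<le> n\<close> keeps the upper entry of its binomial below
    \<open>n\<close>.\<close>
  have eq: "(\<Sum>\<^sub>\<nat>q. t a b d e f g k p q) = (\<Sum>q\<le>n. t a b d e f g k p q)" for a b d e f g k p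
    by (rule Sum_any_atMost) (use ij j in \<open>simp add: t_def binomial_eq_0\<close>)
  have ep: "(\<Sum>\<^sub>\<nat>p. \<Sum>q\<le>n. t a b d e f g k p q) = (\<Sum>p\<le>n. \<Sum>q\<le>n. t a b d e f g k p q)" for a b d e f g k
    by (rule Sum_any_atMost) (use ij j in \<open>simp add: t_def binomial_eq_0\<close>)
  have ek: "(\<Sum>\<^sub>\<nat>k. \<Sum>p\<le>n. \<Sum>q\<le>n. t a b d e f g k p q) = (\<Sum>k\<le>n. \<Sum>p\<le>n. \<Sum>q\<le>n. t a b d e f g k p q)"
    for a b d e f g
    by (rule Sum_any_atMost) (use ij j in \<open>simp add: t_def binomial_eq_0\<close>)
  have eg: "(\<Sum>\<^sub>\<nat>g. \<Sum>k\<le>n. \<Sum>p\<le>n. \<Sum>q\<le>n. t a b d e f g k p q) =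
      (\<Sum>g\<le>n. \<Sum>k\<le>n. \<Sum>p\<le>n. \<Sum>q\<le>n. t a b d e f g k p q)" for a b d e f
    by (rule Sum_any_atMost) (use ij j in \<open>simp add: t_def trinom_def\<close>)
  have ef: "(\<Sum>\<^sub>\<nat>f. \<Sum>g\<le>n. \<Sum>k\<le>n. \<Sum>p\<le>n. \<Sum>q\<le>n. t a b d e f g k p q) =
      (\<Sum>f\<le>n. \<Sum>g\<le>n. \<Sum>k\<le>n. \<Sum>p\<le>n. \<Sum>q\<le>n. t a b d e f g k p q)" for a b d e
    by (rule Sum_any_atMost) (use ij j in \<open>simp add: t_def trinom_def\<close>)
  have ee: "(\<Sum>\<^sub>\<nat>e. \<Sum>f\<le>n. \<Sum>g\<le>n. \<Sum>k\<le>n. \<Sum>p\<le>n. \<Sum>q\<le>n. t a b d e f g k p q) =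
      (\<Sum>e\<le>n. \<Sum>f\<le>n. \<Sum>g\<le>n. \<Sum>k\<le>n. \<Sum>p\<le>n. \<Sum>q\<le>n. t a b d e f g k p q)" for a b d
    by (rule Sum_any_atMost) (use ij j in \<open>simp add: t_def trinom_def\<close>)
  have ed: "(\<Sum>\<^sub>\<nat>d. \<Sum>e\<le>n. \<Sum>f\<le>n. \<Sum>g\<le>n. \<Sum>k\<le>n. \<Sum>p\<le>n. \<Sum>q\<le>n. t a b d e f g k p q) =
      (\<Sum>d\<le>n. \<Sum>e\<le>n. \<Sum>f\<le>n. \<Sum>g\<le>n. \<Sum>k\<le>n. \<Sum>p\<le>n. \<Sum>q\<le>n. t a b d e f g k p q)" for a b
    by (rule Sum_any_atMost) (use ij j in \<open>simp add: t_def trinom_def\<close>)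
  have eb: "(\<Sum>\<^sub>\<nat>b. \<Sum>d\<le>n. \<Sum>e\<le>n. \<Sum>f\<le>n. \<Sum>g\<le>n. \<Sum>k\<le>n. \<Sum>p\<le>n. \<Sum>q\<le>n. t a b d e f g k p q) =
      (\<Sum>b\<le>n. \<Sum>d\<le>n. \<Sum>e\<le>n. \<Sum>f\<le>n. \<Sum>g\<le>n. \<Sum>k\<le>n. \<Sum>p\<le>n. \<Sum>q\<le>n. t a b d e f g k p q)" for a
    by (rule Sum_any_atMost) (use ij j in \<open>simp add: t_def trinom_def\<close>)
  have ea: "(\<Sum>\<^sub>\<nat>a. \<Sum>b\<le>n. \<Sum>d\<le>n. \<Sum>e\<le>n. \<Sum>f\<le>n. \<Sum>g\<le>n. \<Sum>k\<le>n. \<Sum>p\<le>n. \<Sum>q\<le>n. t a b d e f g k p q) =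
      (\<Sum>a\<le>n. \<Sum>b\<le>n. \<Sum>d\<le>n. \<Sum>e\<le>n. \<Sum>f\<le>n. \<Sum>g\<le>n. \<Sum>k\<le>n. \<Sum>p\<le>n. \<Sum>q\<le>n. t a b d e f g k p q)"
    by (rule Sum_any_atMost) (use ij j in \<open>simp add: t_def trinom_def\<close>)
  have summand: "((i - 1) choose a) * ((j - i - 1) choose d) * ((n - j) choose f) *
      (((i - 1 - a) choose b) * ((j - i - 1 - d) choose e) * ((n - j - f) choose g) *
        (descent_free c a * (c - 2) ^ d * (c - 1) ^ f * (descent_free c b * c ^ e * (c - 1) ^ g) *
        (((i - 1 - a - b) choose k) * ((j - i - 1 - d - e) choose p) *
          ((i - 1 - a - b - k + (n - j - f - g)) choose q) * (c - 2) ^ p * k ^ (p + q)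
    * (c - 1) ^ (i - 1 - a - b + (j - i - 1 - d - e) + (n - j - f - g) - k - p)
    * Bell (i - 1 - a - b + (j - i - 1 - d - e) + (n - j - f - g) - k - p - q)))) =
    t a b d e f g k p q" (is "?l = _") for a b d e f g k p q
  proof (cases "a + b + k \<le> i - 1 \<and> d + e + p \<le> j - i - 1 \<and> f + g \<le> n - j")
    case True
    \<comment> \<open>The slacks \<open>x\<close>, \<open>y\<close>, \<open>z\<close> count what is
      left in each region once \<open>k\<close> and \<open>p\<close> are taken out; in these terms
      the differences reduce to cancellation.\<close>
    obtain x where x: "i = a + b + k + x + 1"
      using True i by (metis add.commute le_add_diff_inverse2 le_iff_add)
    have "i + 1 + (d + e + p) \<le> j" using True ij by linarith
    then obtain y where y: "j = i + 1 + (d + e + p) + y" using le_Suc_ex by blast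
    have "j + (f + g) \<le> n" using True j by linarith
    then obtain z where z: "n = j + (f + g) + z" using le_Suc_ex by blast
    have u: "i - 1 - a - b = k + x" "i - a - b - 1 = k + x" "j - i - 1 - d - e = p + y"
        "j - i - d - e - 1 = p + y" "n - j - f - g = z"
      using x y z by simp_all
    have q: "n + i - a - b - f - g - j - k - 1 = k + x - k + z"
      unfolding diff_diff_left using x z by simp
    have B: "n - a - b - d - e - f - g - k - p - q - 2 = k + x + (p + y) + z - k - p - q"
      unfolding diff_diff_left using x y z by simp
    have "n - a - b - d - e - k - p - 2 = f + g + (k + x + (p + y) + z - k - p)"
      unfolding diff_diff_left using x y z by simp
    then have E: "(c - 1) ^ (n - a - b - d - e - k - p - 2) =
      (c - 1) ^ f * (c - 1) ^ g * (c - 1) ^ (k + x + (p + y) + z - k - p)"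
      by (simp only: power_add)
    show ?thesis
      unfolding t_def trinom_eq E q B u power_add[of "c - 2"] by (simp only: mult_ac)
  next
    case False
    \<comment> \<open>A violated size bound makes the binomials of its region vanish, so both sides
      are 0 regardless of truncated differences elsewhere.\<close>
    have "trinom (i - 1) a b * ((i - 1 - a - b) choose k) = 0 \<or>
      trinom (j - i - 1) d e * ((j - i - 1 - d - e) choose p) = 0 \<or> trinom (n - j) f g = 0"
    proof (rule ccontr)
      assume H: "\<not> ?thesis"
      then have "a + b \<le> i - 1" "k \<le> i - 1 - a - b" "d + e \<le> j - i - 1" "p \<le> j - i - 1 - d - e"
        "f + g \<le> n - j"
        by (auto simp: trinom_def binomial_eq_0_iff not_less split: if_splits)
      then show False using False by linarith
    qed
    moreover have x: "i - a - b - 1 = i - 1 - a - b" "j - i - d - e - 1 = j - i - 1 - d - e" by simp_all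
    ultimately have "t a b d e f g k p q = 0"
      and "((i - 1) choose a) * ((i - 1 - a) choose b) * ((i - 1 - a - b) choose k) = 0 \<or>
        ((j - i - 1) choose d) * ((j - i - 1 - d) choose e) * ((j - i - 1 - d - e) choose p) = 0 \<or>
        ((n - j) choose f) * ((n - j - f) choose g) = 0"
      unfolding t_def x trinom_eq by auto
    moreover from this(2) have "?l = 0" by auto
    ultimately show ?thesis by simp
  qed
  have "?rhs = (\<Sum>a\<le>n. \<Sum>d\<le>n. \<Sum>f\<le>n. \<Sum>b\<le>n. \<Sum>e\<le>n. \<Sum>g\<le>n. \<Sum>k\<le>n. \<Sum>p\<le>n. \<Sum>q\<le>n. t a b d e f g k p q)"
    unfolding rest_count_def sum_distrib_left summand ..
  also have "\<dots> = (\<Sum>a\<le>n. \<Sum>b\<le>n. \<Sum>d\<le>n. \<Sum>e\<le>n. \<Sum>f\<le>n. \<Sum>g\<le>n. \<Sum>k\<le>n. \<Sum>p\<le>n. \<Sum>q\<le>n. t a b d e f g k p q)"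
    by (intro sum.cong refl sum_reorder)
  also have "\<dots> = ?lhs"
    unfolding el eq ep ek eg ef ee ed eb ea ..
  finally show ?thesis by (rule sym)
qed

theorem theorem5p8:
  fixes n c \<alpha> \<beta> :: nat
  assumes "n \<ge> 1" and "c \<ge> 2"
    and "\<alpha> \<in> {1..c}" and "\<beta> \<in> {1..c}" and "\<alpha> \<noteq> \<beta>"
  shows "card (eq_avoiders_112 n c \<alpha> \<beta>) =
    Bell n * (c - 1) ^ n
    + (\<Sum>k=1..n. \<Sum>j=1..k. (n choose k) * (k choose j) * Bell (n - k) * (c - 1) ^ (n - j))
    + (\<Sum>(i, j)\<in>{(i, j). 1 \<le> i \<and> i < j \<and> j \<le> n}.
        \<Sum>\<^sub>\<nat>a b. \<Sum>\<^sub>\<nat>d e. \<Sum>\<^sub>\<nat>f g. \<Sum>\<^sub>\<nat>k. \<Sum>\<^sub>\<nat>p q. \<Sum>\<^sub>\<nat>l.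
          trinom (i - 1) a b * trinom (j - i - 1) d e * trinom (n - j) f g
          * ((i - a - b - 1) choose k) * ((j - i - d - e - 1) choose p)
          * ((n + i - a - b - f - g - j - k - 1) choose q)
          * Stirling (p + q) l * falling_fact k l
          * Bell (n - a - b - d - e - f - g - k - p - q - 2)
          * ((c - 1) ^ b + b * (c - 1) ^ (b - 1))
          * ((c - 1) ^ a + a * (c - 1) ^ (a - 1))
          * (c - 2) ^ (d + p) * c ^ e
          * (c - 1) ^ (n - a - b - d - e - k - p - 2))"
proof -
  let ?T = "\<lambda>i j.
        \<Sum>\<^sub>\<nat>a b. \<Sum>\<^sub>\<nat>d e. \<Sum>\<^sub>\<nat>f g. \<Sum>\<^sub>\<nat>k. \<Sum>\<^sub>\<nat>p q. \<Sum>\<^sub>\<nat>l.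
          trinom (i - 1) a b * trinom (j - i - 1) d e * trinom (n - j) f g
          * ((i - a - b - 1) choose k) * ((j - i - d - e - 1) choose p)
          * ((n + i - a - b - f - g - j - k - 1) choose q)
          * Stirling (p + q) l * falling_fact k l
          * Bell (n - a - b - d - e - f - g - k - p - q - 2)
          * ((c - 1) ^ b + b * (c - 1) ^ (b - 1))
          * ((c - 1) ^ a + a * (c - 1) ^ (a - 1))
          * (c - 2) ^ (d + p) * c ^ e
          * (c - 1) ^ (n - a - b - d - e - k - p - 2)"
  have "(\<Sum>(i, j)\<in>{(i, j). 1 \<le> i \<and> i < j \<and> j \<le> n}. partition_sum (block_count \<alpha> \<beta> c i j) {1..n}) =
      (\<Sum>(i, j)\<in>{(i, j). 1 \<le> i \<and> i < j \<and> j \<le> n}. ?T i j)"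
  proof (rule sum.cong[OF refl])
    fix z assume "z \<in> {(i, j). 1 \<le> i \<and> i < j \<and> j \<le> n}"
    then obtain i j where z: "z = (i, j)" and ij: "1 \<le> i" "i < j" "j \<le> n" by blast
    show "(case z of (i, j) \<Rightarrow> partition_sum (block_count \<alpha> \<beta> c i j) {1..n}) = (case z of (i, j) \<Rightarrow> ?T i j)"
      unfolding z case_prod_conv
      by (rule trans[OF partition_sum_block_count[OF assms(2-5) ij] Sum_any_eq_sums[OF ij, symmetric]])
  qed
  then show ?thesis by (simp only: card_avoiders[OF assms(3)])
qed

end
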